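(* Let $\mathbf r_1,\dots,\mathbf r_m$ be independent random vectors in $\mathbb{R}^n$, where $\mathbf r_i$ has finite support $S_i$. There is an algorithm that, for any $1\le\ell\le m$, any $(\mathbf r_1,\dots,\mathbf r_\ell)\in S_1\times\dots\times S_\ell$, and any $1\le k\le n$, returns the top $k$ coefficients of the polynomial \[ f_{\mathbf r_1,\dots,\mathbf r_\ell}(x)=\mathbb{E}_{\mathbf r_{\ell+1},\dots,\mathbf r_m}\left[\det\Big(xI-\sum_{i=1}^m\mathbf r_i\mathbf r_i^T\Big)\right] \] (expectation over the random $\mathbf r_{\ell+1},\dots,\mathbf r_m$ with $\mathbf r_1,\dots,\mathbf r_\ell$ fixed) in time $(m\cdot\max_i|S_i|)^k\,\mathrm{poly}(n)$.
   Context: The top $k$ coefficients of the degree-$n$ monic polynomial $x^n+c_1x^{n-1}+\dots+c_n$ are $c_1,\dots,c_k$. Computations are with exact real arithmetic on the given vectors and probabilities. *)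

theory Defs
  imports
    "HOL-Probability.Product_PMF"
    "HOL-Computational_Algebra.Polynomial"
    "Jordan_Normal_Form.Determinant"
begin

unbundle no vec_syntax

text \<open>
  The model of computation is a real RAM, programmed by structured while programs.  Memory consists
  of finitely many named arrays of natural numbers (for indices and counters) and of real numbers
  (exact arithmetic).  An array is addressed by a list of natural numbers; a scalar is the cell with
  address \<^term>\<open>[]\<close>.  Every arithmetic operation, memory access, comparison and assignment has unit
  cost.  Index arithmetic is limited to addition and truncated subtraction, there is no rounding
  from reals to integers, and the only real constants are integers, so that a program cannot
  carry information in its constants.
\<close>

record state =
  nmem :: "string \<Rightarrow> nat list \<Rightarrow> nat"
  rmem :: "string \<Rightarrow> nat list \<Rightarrow> real"

datatype nexp =
    NConst nat
  | NGet string "nexp list"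
  | NAdd nexp nexp
  | NSub nexp nexp

datatype rexp =
    RConst int
  | RGet string "nexp list"
  | RAdd rexp rexp
  | RSub rexp rexp
  | RMul rexp rexp
  | RDiv rexp rexp

datatype bexp =
    NLess nexp nexp
  | RLess rexp rexp
  | BNot bexp
  | BAnd bexp bexp

datatype com =
    Skip
  | NAssign string "nexp list" nexp
  | RAssign string "nexp list" rexp
  | Seq com com
  | Cond bexp com com
  | While bexp com

fun nval :: "nexp \<Rightarrow> state \<Rightarrow> nat" where
  "nval (NConst c) s = c"
| "nval (NGet x es) s = nmem s x (map (\<lambda>e. nval e s) es)"
| "nval (NAdd e f) s = nval e s + nval f s"
| "nval (NSub e f) s = nval e s - nval f s"

(* Division by zero yields 0; since programs can test for zero, this convention only affects
   constant factors of the running time. *)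
fun rval :: "rexp \<Rightarrow> state \<Rightarrow> real" where
  "rval (RConst c) s = of_int c"
| "rval (RGet x es) s = rmem s x (map (\<lambda>e. nval e s) es)"
| "rval (RAdd e f) s = rval e s + rval f s"
| "rval (RSub e f) s = rval e s - rval f s"
| "rval (RMul e f) s = rval e s * rval f s"
| "rval (RDiv e f) s = rval e s / rval f s"

fun bval :: "bexp \<Rightarrow> state \<Rightarrow> bool" where
  "bval (NLess e f) s = (nval e s < nval f s)"
| "bval (RLess e f) s = (rval e s < rval f s)"
| "bval (BNot b) s = (\<not> bval b s)"
| "bval (BAnd b c) s = (bval b s \<and> bval c s)"

fun ncost :: "nexp \<Rightarrow> nat" where
  "ncost (NConst c) = 1"
| "ncost (NGet x es) = 1 + sum_list (map ncost es)"
| "ncost (NAdd e f) = 1 + ncost e + ncost f"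
| "ncost (NSub e f) = 1 + ncost e + ncost f"

fun rcost :: "rexp \<Rightarrow> nat" where
  "rcost (RConst c) = 1"
| "rcost (RGet x es) = 1 + sum_list (map ncost es)"
| "rcost (RAdd e f) = 1 + rcost e + rcost f"
| "rcost (RSub e f) = 1 + rcost e + rcost f"
| "rcost (RMul e f) = 1 + rcost e + rcost f"
| "rcost (RDiv e f) = 1 + rcost e + rcost f"

fun bcost :: "bexp \<Rightarrow> nat" where
  "bcost (NLess e f) = 1 + ncost e + ncost f"
| "bcost (RLess e f) = 1 + rcost e + rcost f"
| "bcost (BNot b) = 1 + bcost b"
| "bcost (BAnd b c) = 1 + bcost b + bcost c"

definition nwrite :: "string \<Rightarrow> nat list \<Rightarrow> nat \<Rightarrow> state \<Rightarrow> state" where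
  "nwrite x a v s = s\<lparr>nmem := (nmem s)(x := (nmem s x)(a := v))\<rparr>"

definition rwrite :: "string \<Rightarrow> nat list \<Rightarrow> real \<Rightarrow> state \<Rightarrow> state" where
  "rwrite x a v s = s\<lparr>rmem := (rmem s)(x := (rmem s x)(a := v))\<rparr>"

text \<open>\<open>exec c s t s'\<close>: started in state \<open>s\<close>, program \<open>c\<close> halts in state \<open>s'\<close> after \<open>t\<close> steps.\<close>

inductive exec :: "com \<Rightarrow> state \<Rightarrow> nat \<Rightarrow> state \<Rightarrow> bool" where
  Skip: "exec Skip s 1 s"
| NAssign: "exec (NAssign x es e) s (1 + sum_list (map ncost es) + ncost e)
    (nwrite x (map (\<lambda>e. nval e s) es) (nval e s) s)"
| RAssign: "exec (RAssign x es e) s (1 + sum_list (map ncost es) + rcost e)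
    (rwrite x (map (\<lambda>e. nval e s) es) (rval e s) s)"
| Seq: "exec c s t s' \<Longrightarrow> exec d s' t' s'' \<Longrightarrow> exec (Seq c d) s (t + t') s''"
| CondTrue: "bval b s \<Longrightarrow> exec c s t s' \<Longrightarrow> exec (Cond b c d) s (1 + bcost b + t) s'"
| CondFalse: "\<not> bval b s \<Longrightarrow> exec d s t s' \<Longrightarrow> exec (Cond b c d) s (1 + bcost b + t) s'"
| WhileFalse: "\<not> bval b s \<Longrightarrow> exec (While b c) s (1 + bcost b) s"
| WhileTrue: "bval b s \<Longrightarrow> exec c s t s' \<Longrightarrow> exec (While b c) s' t' s'' \<Longrightarrow>
    exec (While b c) s (1 + bcost b + t + t') s''"

inductive_cases SkipE: "exec Skip s t s'"
inductive_cases NAssignE: "exec (NAssign x es e) s t s'"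
inductive_cases RAssignE: "exec (RAssign x es e) s t s'"
inductive_cases SeqE: "exec (Seq c d) s t s'"
inductive_cases CondE: "exec (Cond b c d) s t s'"
inductive_cases WhileE: "exec (While b c) s t s'"

lemma exec_deterministic:
  "exec c s t s' \<Longrightarrow> exec c s u u' \<Longrightarrow> u = t \<and> u' = s'"
proof (induction arbitrary: u u' rule: exec.induct)
  case (Skip s)
  then show ?case by (auto elim: SkipE)
next
  case (NAssign x es e s)
  then show ?case by (auto elim: NAssignE)
next
  case (RAssign x es e s)
  then show ?case by (auto elim: RAssignE)
next
  case (Seq c s t s' d t' s'')
  from Seq.prems obtain t1 s1 t2 where "exec c s t1 s1" "exec d s1 t2 u'" "u = t1 + t2"
    by (auto elim: SeqE)
  then show ?case using Seq.IH by metis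
next
  case (CondTrue b s c t s' d)
  from CondTrue.prems CondTrue.hyps obtain t1 where "exec c s t1 u'" "u = 1 + bcost b + t1"
    by (auto elim: CondE)
  then show ?case using CondTrue.IH by metis
next
  case (CondFalse b s d t s' c)
  from CondFalse.prems CondFalse.hyps obtain t1 where "exec d s t1 u'" "u = 1 + bcost b + t1"
    by (auto elim: CondE)
  then show ?case using CondFalse.IH by metis
next
  case (WhileFalse b s c)
  from WhileFalse.prems show ?case by (rule WhileE) (use WhileFalse.hyps in simp_all)
next
  case (WhileTrue b s c t s' t' s'')
  from WhileTrue.prems WhileTrue.hyps obtain t1 s1 t2
    where "exec c s t1 s1" "exec (While b c) s1 t2 u'" "u = 1 + bcost b + t1 + t2"
    by (auto elim: WhileE)
  then show ?case using WhileTrue.IH by metis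
qed

text \<open>
  The input.  The distribution of the \<open>i\<close>-th random vector, for \<open>i\<close> from 1 to \<open>m\<close>, is given by a
  list \<open>S i\<close> of the elements of its support together with their probabilities; \<open>r i\<close>, for \<open>i\<close> from
  1 to \<open>l\<close>, are the fixed vectors.  Positions in \<open>S i\<close> and coordinates are counted from 0.  All
  cells that do not hold input data are 0.
\<close>

definition scalar :: "nat \<Rightarrow> nat list \<Rightarrow> nat" where
  "scalar v = (\<lambda>_. 0)([] := v)"

definition input_state ::
  "nat \<Rightarrow> nat \<Rightarrow> (nat \<Rightarrow> real vec pmf) \<Rightarrow> (nat \<Rightarrow> real vec list) \<Rightarrow>
   nat \<Rightarrow> (nat \<Rightarrow> real vec) \<Rightarrow> nat \<Rightarrow> state" where
  "input_state n m p S l r k = \<lparr>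
     nmem = (\<lambda>_ _. 0)
       (''n'' := scalar n,
        ''m'' := scalar m,
        ''l'' := scalar l,
        ''k'' := scalar k,
        ''size'' := (\<lambda>is. case is of [i] \<Rightarrow> if i \<in> {1..m} then length (S i) else 0 | _ \<Rightarrow> 0)),
     rmem = (\<lambda>_ _. 0)
       (''supp'' := (\<lambda>is. case is of [i, a, c] \<Rightarrow>
            if i \<in> {1..m} \<and> a < length (S i) \<and> c < n then (S i ! a) $ c else 0 | _ \<Rightarrow> 0),
        ''prob'' := (\<lambda>is. case is of [i, a] \<Rightarrow>
            if i \<in> {1..m} \<and> a < length (S i) then pmf (p i) (S i ! a) else 0 | _ \<Rightarrow> 0),
        ''fixed'' := (\<lambda>is. case is of [i, c] \<Rightarrow>
            if i \<in> {1..l} \<and> c < n then r i $ c else 0 | _ \<Rightarrow> 0))\<rparr>"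

definition outer :: "real vec \<Rightarrow> real mat" where
  "outer v = Matrix.mat (dim_vec v) (dim_vec v) (\<lambda>(a, b). v $ a * v $ b)"

definition outer_sum :: "nat \<Rightarrow> nat \<Rightarrow> (nat \<Rightarrow> real vec) \<Rightarrow> real mat" where
  "outer_sum n m v = Matrix.mat n n (\<lambda>ab. \<Sum>i = 1..m. outer (v i) $$ ab)"

text \<open>
  The random vectors are independent with distributions \<open>p i\<close>, so the joint distribution of those
  with index in \<open>{l+1..m}\<close> is the product of the \<open>p i\<close>.  The default value \<open>0\<^sub>v n\<close> of
  \<^const>\<open>Pi_pmf\<close> outside this index set is never used.
\<close>

definition expected_charpoly ::
  "nat \<Rightarrow> nat \<Rightarrow> (nat \<Rightarrow> real vec pmf) \<Rightarrow> nat \<Rightarrow> (nat \<Rightarrow> real vec) \<Rightarrow> real \<Rightarrow> real" where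
  "expected_charpoly n m p l r x =
     measure_pmf.expectation (Pi_pmf {l+1..m} (0\<^sub>v n) p)
       (\<lambda>\<omega>. Determinant.det (x \<cdot>\<^sub>m 1\<^sub>m n - outer_sum n m (\<lambda>i. if i \<le> l then r i else \<omega> i)))"

definition top_coeffs :: "nat \<Rightarrow> nat \<Rightarrow> (real \<Rightarrow> real) \<Rightarrow> (nat \<Rightarrow> real) \<Rightarrow> bool" where
  "top_coeffs n k f out \<longleftrightarrow>
     (\<exists>c. (\<forall>x. f x = x ^ n + (\<Sum>j = 1..n. c j * x ^ (n - j))) \<and> (\<forall>j\<in>{1..k}. out j = c j))"

end

theory Submission
  imports Defs "Jordan_Normal_Form.Char_Poly"
begin

unbundle no inner_syntax

text \<open>
  Let \<open>P\<close> be an orthogonal projection, \<open>d = v\<^sup>T P v\<close>, and let \<open>P' = P - P v v\<^sup>T P / d\<close> be the projection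
  that kills \<open>v\<close> as well.  By the matrix determinant lemma
  \<open>det (1 + (B + c v v\<^sup>T) P) = det (1 + B P) + c d det (1 + B P')\<close>.
  Taking expectations over one random vector after the other, this expands
  \<open>E det (1 - y \<Sum> r\<^sub>i r\<^sub>i\<^sup>T)\<close> into a sum over increasing index sequences \<open>i\<^sub>1 < \<dots> < i\<^sub>j\<close> with a choice of
  a support vector for each index; the summand is \<open>(- y) ^ j\<close> times the product of the probabilities
  and of the numbers \<open>d\<close>, that is, times the Gram determinant of the chosen vectors.
  The coefficient of \<open>x ^ (n - j)\<close> of the expected characteristic polynomial is the coefficient of
  \<open>y ^ j\<close>, which has at most \<open>(m * max |S\<^sub>i|) ^ j\<close> summands.  The program enumerates the sequences
  breadth first: a node of level \<open>j\<close> stores its projection, its last index and its signed weight,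
  so a child costs \<open>O (n\<^sup>2)\<close> steps.
\<close>

section \<open>Rank-one updates of determinants\<close>

definition rank1 :: "real vec \<Rightarrow> real vec \<Rightarrow> real mat" where
  "rank1 u w = Matrix.mat (dim_vec u) (dim_vec w) (\<lambda>(a, b). u $ a * w $ b)"

lemma rank1_carrier [simp]:
  "u \<in> carrier_vec n \<Longrightarrow> w \<in> carrier_vec k \<Longrightarrow> rank1 u w \<in> carrier_mat n k"
  by (simp add: rank1_def)

lemma outer_eq_rank1: "outer v = rank1 v v"
  by (simp add: outer_def rank1_def)

lemma rank1_mult_mat:
  assumes "u \<in> carrier_vec n" "w \<in> carrier_vec n" "P \<in> carrier_mat n n" "transpose_mat P = P"
  shows "rank1 u w * P = rank1 u (P *\<^sub>v w)"
proof (rule eq_matI)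
  fix a b assume "a < dim_row (rank1 u (P *\<^sub>v w))" "b < dim_col (rank1 u (P *\<^sub>v w))"
  then have a: "a < n" and b: "b < n" using assms by (auto simp: rank1_def)
  have "P $$ (b, i) = P $$ (i, b)" if "i < n" for i
    using assms(3,4) b that by (metis carrier_matD index_transpose_mat(1))
  then show "(rank1 u w * P) $$ (a, b) = rank1 u (P *\<^sub>v w) $$ (a, b)"
    using a b assms by (auto simp: rank1_def scalar_prod_def sum_distrib_left intro!: sum.cong)
qed (use assms in \<open>auto simp: rank1_def\<close>)

lemma mat_mult_rank1:
  assumes "u \<in> carrier_vec n" "w \<in> carrier_vec n" "B \<in> carrier_mat n n"
  shows "B * rank1 u w = rank1 (B *\<^sub>v u) w"
  by (rule eq_matI) (use assms in \<open>auto simp: rank1_def scalar_prod_def sum_distrib_right intro!: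
      sum.cong\<close>)

text \<open>Column elimination with the corner entry 1 as pivot clears the lower left border and
  leaves a Schur complement in the upper left block.\<close>

lemma bordered_mult_right:
  fixes A :: "real mat"
  assumes "A \<in> carrier_mat n n" "u \<in> carrier_vec n" "w \<in> carrier_vec n"
  shows "four_block_mat A (mat_of_cols n [u]) (mat_of_rows n [- w]) (1\<^sub>m 1)
          * four_block_mat (1\<^sub>m n) (0\<^sub>m n 1) (mat_of_rows n [w]) (1\<^sub>m 1)
       = four_block_mat (A + rank1 u w) (mat_of_cols n [u]) (0\<^sub>m 1 n) (1\<^sub>m 1)"
proof -
  have 1: "mat_of_cols n [u] * mat_of_rows n [w] = rank1 u w"
    by (rule eq_matI) (use assms in \<open>auto simp: rank1_def scalar_prod_def mat_of_cols_def
        mat_of_rows_def\<close>)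
  have 2: "mat_of_rows n [- w] + mat_of_rows n [w] = 0\<^sub>m 1 n"
    by (rule eq_matI) (use assms in \<open>auto simp: mat_of_rows_def\<close>)
  have 3: "0\<^sub>m n (Suc 0) + mat_of_cols n [u] = mat_of_cols n [u]"
    by (rule eq_matI) (use assms in \<open>auto simp: mat_of_cols_def\<close>)
  show ?thesis
    by (subst mult_four_block_mat[where ?nr1.0=n and ?n1.0=n and ?n2.0=1 and ?nr2.0=1 and ?nc1.0=n
        and ?nc2.0=1])
      (use assms in \<open>auto simp: 1 2 3\<close>)
qed

text \<open>The elimination factor has determinant 1 and the product is block triangular. In the
  bordered form \<open>u\<close> fills a single column, which makes the dependence on
  \<open>u\<close> accessible to Laplace expansion.\<close>

lemma det_bordered:
  fixes A :: "real mat"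
  assumes "A \<in> carrier_mat n n" "u \<in> carrier_vec n" "w \<in> carrier_vec n"
  shows "det (four_block_mat A (mat_of_cols n [u]) (mat_of_rows n [- w]) (1\<^sub>m 1)) =
      det (A + rank1 u w)"
    (is "det ?K = _")
proof -
  let ?E = "four_block_mat (1\<^sub>m n) (0\<^sub>m n 1) (mat_of_rows n [w]) (1\<^sub>m 1) :: real mat"
  have "det ?K = det ?K * det ?E"
    by (subst (2) det_four_block_mat_upper_right_zero[where n=n and m=1]) auto
  also have "\<dots> = det (?K * ?E)"
    by (rule det_mult[symmetric, where n="n+1"]) (use assms in auto)
  also have "\<dots> = det (A + rank1 u w)"
    unfolding bordered_mult_right[OF assms]
    by (subst det_four_block_mat_lower_left_zero[where n=n and m=1]) (use assms in auto)
  finally show ?thesis .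
qed

text \<open>Elimination from the left uses the identity block as pivot instead, so the Schur
  complement is the 1 by 1 block with entry \<open>1 + u \<bullet> w\<close>. Comparing both
  eliminations is Sylvester's identity.\<close>

lemma det_one_plus_rank1:
  assumes "u \<in> carrier_vec n" "w \<in> carrier_vec n"
  shows "det (1\<^sub>m n + rank1 u w) = 1 + u \<bullet> w"
proof -
  let ?K = "four_block_mat (1\<^sub>m n) (mat_of_cols n [u]) (mat_of_rows n [- w]) (1\<^sub>m 1) :: real mat"
  let ?E = "four_block_mat (1\<^sub>m n) (0\<^sub>m n 1) (mat_of_rows n [w]) (1\<^sub>m 1) :: real mat"
  have 1: "mat_of_rows n [w] * mat_of_cols n [u] = (u \<bullet> w) \<cdot>\<^sub>m 1\<^sub>m 1"
    by (rule eq_matI) (use assms in \<open>auto simp: scalar_prod_def mat_of_cols_def mat_of_rows_def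
        mult.commute\<close>)
  have 2: "mat_of_rows n [w] + mat_of_rows n [- w] = 0\<^sub>m 1 n"
    by (rule eq_matI) (use assms in \<open>auto simp: mat_of_rows_def\<close>)
  have *: "?E * ?K = four_block_mat (1\<^sub>m n) (mat_of_cols n [u]) (0\<^sub>m 1 n) ((u \<bullet> w) \<cdot>\<^sub>m 1\<^sub>m 1 + 1\<^sub>m 1)"
    by (subst mult_four_block_mat[where ?nr1.0=n and ?n1.0=n and ?n2.0=1 and ?nr2.0=1 and ?nc1.0=n
        and ?nc2.0=1])
      (use assms in \<open>auto simp: 1 2\<close>)
  have "det (1\<^sub>m n + rank1 u w) = det ?K"
    using assms by (subst det_bordered) auto
  also have "\<dots> = det ?E * det ?K"
    by (subst (2) det_four_block_mat_upper_right_zero[where n=n and m=1]) auto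
  also have "\<dots> = det (?E * ?K)"
    by (rule det_mult[symmetric, where n="n+1"]) (use assms in auto)
  also have "\<dots> = 1 + u \<bullet> w"
    unfolding * by (subst det_four_block_mat_lower_left_zero[where n=n and m=1])
      (auto simp: det_single)
  finally show ?thesis .
qed

text \<open>The matrix determinant lemma; \<open>C\<close> is the product of the adjugate of \<open>A\<close> with \<open>w\<close>.\<close>
lemma det_plus_rank1_linear:
  fixes A :: "real mat"
  assumes A: "A \<in> carrier_mat n n" and w: "w \<in> carrier_vec n"
  obtains C where "C \<in> carrier_vec n"
    "\<And>u. u \<in> carrier_vec n \<Longrightarrow> det (A + rank1 u w) = det A + u \<bullet> C"
proof -
  let ?K = "\<lambda>u. four_block_mat A (mat_of_cols n [u]) (mat_of_rows n [- w]) (1\<^sub>m 1) :: real mat"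
  define C where "C = vec n (\<lambda>i. cofactor (?K (0\<^sub>v n)) i n)"
  define c where "c = cofactor (?K (0\<^sub>v n)) n n"
  \<comment> \<open>\<open>u\<close> occurs only in the last column, which these minors delete, so
    they may be taken at \<open>u = 0\<close>.\<close>
  have cof: "cofactor (?K u) i n = cofactor (?K (0\<^sub>v n)) i n" if "u \<in> carrier_vec n" "i \<le> n" for u i
  proof -
    have "mat_delete (?K u) i n = mat_delete (?K (0\<^sub>v n)) i n"
      unfolding mat_delete_def
      by (rule cong_mat) (use assms that in \<open>auto simp: four_block_mat_def Let_def\<close>)
    then show ?thesis by (simp add: cofactor_def)
  qed
  have exp: "det (A + rank1 u w) = c + u \<bullet> C" if u: "u \<in> carrier_vec n" for u
  proof -
    have "det (A + rank1 u w) = det (?K u)" using det_bordered[OF A u w] by simp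
    also have "\<dots> = (\<Sum>i<n+1. ?K u $$ (i, n) * cofactor (?K u) i n)"
      by (rule laplace_expansion_column) (use A in auto)
    also have "\<dots> = (\<Sum>i<n. u $ i * C $ i) + c"
    proof -
      have "?K u $$ (i, n) = u $ i" if "i < n" for i using that A by (simp add: mat_of_cols_def)
      moreover have "?K u $$ (n, n) = 1" using A by simp
      ultimately show ?thesis
        by (simp add: cof[OF u] C_def c_def Suc_eq_plus1[symmetric] del: One_nat_def Suc_eq_plus1)
    qed
    also have "\<dots> = c + u \<bullet> C"
      by (simp add: scalar_prod_def C_def lessThan_atLeast0)
    finally show ?thesis .
  qed
  \<comment> \<open>At \<open>u = 0\<close> the perturbation vanishes, which identifies the constant
    \<open>c\<close> as \<open>det A\<close>.\<close>
  have "rank1 (0\<^sub>v n) w = 0\<^sub>m n n"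
    by (rule eq_matI) (use w in \<open>auto simp: rank1_def\<close>)
  then have "c = det A" using exp[of "0\<^sub>v n"] A by (auto simp: C_def)
  then show ?thesis using that[of C] exp by (auto simp: C_def)
qed

section \<open>Orthogonal projections and their deflation\<close>

definition is_proj :: "nat \<Rightarrow> real mat \<Rightarrow> bool" where
  "is_proj n P \<longleftrightarrow> P \<in> carrier_mat n n \<and> transpose_mat P = P \<and> P * P = P"

text \<open>If \<open>v \<bullet> (P *\<^sub>v v) = 0\<close> then \<open>1 / 0 = 0\<close> gives \<open>P\<close>, which is right since then \<open>P *\<^sub>v v = 0\<close>.\<close>
definition deflate :: "real mat \<Rightarrow> real vec \<Rightarrow> real mat" where
  "deflate P v = P - (1 / (v \<bullet> (P *\<^sub>v v))) \<cdot>\<^sub>m outer (P *\<^sub>v v)"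

text \<open>Replacing \<open>P\<close> by \<open>P * P\<close> and moving one factor across gives a
  squared norm. So this number vanishes only if \<open>P *\<^sub>v v\<close> does.\<close>

lemma proj_quadratic_form:
  assumes "is_proj n P" "v \<in> carrier_vec n"
  shows "v \<bullet> (P *\<^sub>v v) = (P *\<^sub>v v) \<bullet> (P *\<^sub>v v)"
proof -
  have P: "P \<in> carrier_mat n n" "transpose_mat P = P" "P * P = P" using assms
      by (auto simp: is_proj_def)
  have "v \<bullet> (P *\<^sub>v v) = v \<bullet> (P *\<^sub>v (P *\<^sub>v v))"
    using P assms by (metis assoc_mult_mat_vec)
  also have "\<dots> = (P *\<^sub>v v) \<bullet> (P *\<^sub>v v)"
    using P assms transpose_vec_mult_scalar[of P n n "P *\<^sub>v v" v] by auto
  finally show ?thesis .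
qed

lemma self_scalar_prod_eq_0:
  fixes v :: "real vec"
  assumes "v \<bullet> v = 0" shows "v = 0\<^sub>v (dim_vec v)"
  using assms by (auto simp: scalar_prod_def sum_nonneg_eq_0_iff)

text \<open>For nonzero \<open>w = P *\<^sub>v v\<close> the subtracted matrix is the orthogonal
  projection onto the line of \<open>w\<close>. Since \<open>P\<close> fixes \<open>w\<close>, it is
  absorbed by \<open>P\<close> from either side.\<close>

lemma is_proj_deflate:
  assumes pr: "is_proj n P" and v: "v \<in> carrier_vec n"
  shows "is_proj n (deflate P v)"
proof -
  have P: "P \<in> carrier_mat n n" "transpose_mat P = P" "P * P = P" using pr
      by (auto simp: is_proj_def)
  define w where "w = P *\<^sub>v v"
  define d where "d = v \<bullet> w"
  have w: "w \<in> carrier_vec n" using P v by (simp add: w_def)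
  have dw: "w \<bullet> w = d" using proj_quadratic_form[OF assms] by (simp add: w_def d_def)
  have Pw: "P *\<^sub>v w = w" unfolding w_def using P v by (metis assoc_mult_mat_vec)
  have D: "deflate P v = P - (1/d) \<cdot>\<^sub>m rank1 w w"
      by (simp add: deflate_def w_def d_def outer_eq_rank1)
  have R: "rank1 w w \<in> carrier_mat n n" using w by simp
  have RR: "rank1 w w * rank1 w w = d \<cdot>\<^sub>m rank1 w w"
    by (rule eq_matI) (use w in \<open>auto simp: rank1_def scalar_prod_def dw[symmetric] sum_distrib_left
          sum_distrib_right algebra_simps intro!: sum.cong\<close>)
  have PR: "P * rank1 w w = rank1 w w" "rank1 w w * P = rank1 w w"
    using mat_mult_rank1[OF w w P(1)] rank1_mult_mat[OF w w P(1,2)] Pw by auto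
  have T: "transpose_mat (rank1 w w) = rank1 w w"
    by (rule eq_matI) (use w in \<open>auto simp: rank1_def\<close>)
  let ?R = "(1/d) \<cdot>\<^sub>m rank1 w w"
  have R': "?R \<in> carrier_mat n n" using R by simp
  have ss: "a \<cdot>\<^sub>m (b \<cdot>\<^sub>m X) = (a * b) \<cdot>\<^sub>m X" for a b :: real and X
    by (rule eq_matI) auto
  \<comment> \<open>True for \<open>d = 0\<close> as well, so the degenerate case needs no separate
    treatment.\<close>
  have ds: "(1/d) * ((1/d) * d) = 1/d" by simp
  have R1: "P * ?R = ?R" using PR(1) R P(1) by (metis mult_smult_distrib)
  have R2: "?R * P = ?R" using PR(2) R P(1) by (metis mult_smult_assoc_mat)
  have R3: "?R * ?R = ?R"
    using RR R ds by (metis mult_smult_distrib mult_smult_assoc_mat ss smult_carrier_mat)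
  have "(P - ?R) * (P - ?R) = P - ?R"
  proof -
    have "(P - ?R) * (P - ?R) = P * P - P * ?R - (?R * P - ?R * ?R)"
      using P(1) R' minus_mult_distrib_mat[of P n n ?R "P - ?R" n]
        mult_minus_distrib_mat[of P n n P n ?R] mult_minus_distrib_mat[of ?R n n P n ?R]
      by (simp add: minus_carrier_mat)
    also have "\<dots> = P - ?R - (?R - ?R)" using R1 R2 R3 P(3) by simp
    also have "\<dots> = P - ?R" using P(1) w by (intro eq_matI) (auto simp: rank1_def)
    finally show ?thesis .
  qed
  moreover have "transpose_mat (P - ?R) = P - ?R"
  proof -
    have "transpose_mat ?R = ?R" by (subst (2) T[symmetric]) (auto intro!: eq_matI)
    then show ?thesis using P R' by (metis transpose_minus)
  qed
  ultimately show ?thesis using P(1) R' D by (auto simp: is_proj_def minus_carrier_mat)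
qed

text \<open>The determinants with a changed argument are rank-one perturbations of
  \<open>A = 1\<^sub>m n + B * P\<close> with the same second factor
  \<open>w = P *\<^sub>v v\<close>. Hence one vector \<open>C\<close> governs both, and it remains
  to compare values of \<open>u \<bullet> C\<close>. Nothing is inverted, so \<open>A\<close> may be
  singular.\<close>

lemma det_plus_outer_mult_proj:
  assumes pr: "is_proj n P" and v: "v \<in> carrier_vec n" and B: "B \<in> carrier_mat n n"
  shows "det (1\<^sub>m n + (B + c \<cdot>\<^sub>m outer v) * P)
       = det (1\<^sub>m n + B * P) + c * (v \<bullet> (P *\<^sub>v v)) * det (1\<^sub>m n + B * deflate P v)"
proof -
  have P: "P \<in> carrier_mat n n" "transpose_mat P = P" using pr by (auto simp: is_proj_def)
  define w where "w = P *\<^sub>v v"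
  define d where "d = v \<bullet> w"
  define A where "A = 1\<^sub>m n + B * P"
  have w: "w \<in> carrier_vec n" using P v by (simp add: w_def)
  have A: "A \<in> carrier_mat n n" using P B by (simp add: A_def)
  have smr: "a \<cdot>\<^sub>m rank1 u w = rank1 (a \<cdot>\<^sub>v u) w" for a u
    by (rule eq_matI) (auto simp: rank1_def)
  have L: "1\<^sub>m n + (B + c \<cdot>\<^sub>m outer v) * P = A + rank1 (c \<cdot>\<^sub>v v) w"
  proof -
    have "(c \<cdot>\<^sub>m outer v) * P = rank1 (c \<cdot>\<^sub>v v) w"
      using v P rank1_mult_mat[OF v v P]
      by (simp add: outer_eq_rank1 mult_smult_assoc_mat[where n=n and nr=n and nc=n] smr
          w_def[symmetric])
    moreover have "c \<cdot>\<^sub>m outer v \<in> carrier_mat n n" using v by (simp add: outer_eq_rank1)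
    ultimately have "(B + c \<cdot>\<^sub>m outer v) * P = B * P + rank1 (c \<cdot>\<^sub>v v) w"
      using B P(1) by (simp add: add_mult_distrib_mat)
    then show ?thesis using B P(1) v w by (simp add: A_def assoc_add_mat[where nr=n and nc=n])
  qed
  obtain C where C: "C \<in> carrier_vec n"
    and lin: "\<And>u. u \<in> carrier_vec n \<Longrightarrow> det (A + rank1 u w) = det A + u \<bullet> C"
    using det_plus_rank1_linear[OF A w] by blast
  have l: "det (A + rank1 (c \<cdot>\<^sub>v v) w) = det A + c * (v \<bullet> C)"
    using lin[of "c \<cdot>\<^sub>v v"] v C by simp
  show ?thesis
  proof (cases "d = 0")
    \<comment> \<open>Here \<open>w\<close> is zero, so the perturbation and the second summand both
      vanish.\<close>
    case True
    then have "w \<bullet> w = 0" using proj_quadratic_form[OF pr v] by (simp add: d_def w_def)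
    then have "w = 0\<^sub>v n" using self_scalar_prod_eq_0 w by force
    then have "rank1 (c \<cdot>\<^sub>v v) w = 0\<^sub>m n n"
      using v by (intro eq_matI) (auto simp: rank1_def)
    then show ?thesis unfolding L using True A by (simp add: A_def d_def w_def)
  next
    case False
    have Bw: "B *\<^sub>v w = A *\<^sub>v v - v"
    proof -
      have "A *\<^sub>v v = v + B *\<^sub>v w"
        using B P(1) v by (simp add: A_def w_def add_mult_distrib_mat_vec[where nr=n and nc=n]
            assoc_mult_mat_vec[where n\<^sub>1=n and n\<^sub>2=n and n\<^sub>3=n])
      then show ?thesis using v B w by (intro eq_vecI) auto
    qed
    have "1\<^sub>m n + B * deflate P v = A + rank1 ((- 1/d) \<cdot>\<^sub>v (B *\<^sub>v w)) w"
    proof -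
      have "B * deflate P v = B * P - (1/d) \<cdot>\<^sub>m rank1 (B *\<^sub>v w) w"
        unfolding deflate_def w_def[symmetric] d_def[symmetric] outer_eq_rank1
        using B P(1) w mat_mult_rank1[OF w w B]
        by (simp add: mult_minus_distrib_mat[where nr=n and n=n and nc=n]
            mult_smult_distrib[where nr=n and n=n and nc=n])
      then show ?thesis
        using B P(1) w by (intro eq_matI) (auto simp: A_def rank1_def)
    qed
    then have "det (1\<^sub>m n + B * deflate P v) = det A + ((- 1/d) \<cdot>\<^sub>v (A *\<^sub>v v - v)) \<bullet> C"
      using lin[of "(- 1/d) \<cdot>\<^sub>v (B *\<^sub>v w)"] A v Bw by auto
    also have "\<dots> = det A - (1/d) * ((A *\<^sub>v v) \<bullet> C - v \<bullet> C)"
      using A v C by (simp add: minus_scalar_prod_distrib[where n=n])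
    \<comment> \<open>Perturbing by \<open>A *\<^sub>v v\<close> factors out \<open>A\<close> on the
      left, so this value of the functional follows from multiplicativity of the
      determinant.\<close>
    also have "(A *\<^sub>v v) \<bullet> C = det A * d"
    proof -
      have "A + rank1 (A *\<^sub>v v) w = A * (1\<^sub>m n + rank1 v w)"
        using A v w mat_mult_rank1[OF v w A] by (simp
            add: mult_add_distrib_mat[where n=n and nr=n and nc=n])
      then have "det (A + rank1 (A *\<^sub>v v) w) = det A * (1 + d)"
        using A v w by (simp add: det_mult[where n=n] det_one_plus_rank1 d_def)
      then show ?thesis using lin[of "A *\<^sub>v v"] A v by (simp add: algebra_simps)
    qed
    finally have "d * det (1\<^sub>m n + B * deflate P v) = v \<bullet> C"
      using False by (simp add: field_simps)
    then show ?thesis unfolding L l by (simp add: A_def d_def w_def mult.assoc)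
  qed
qed

section \<open>Expected determinants as sums over index sequences\<close>

context
  fixes m :: nat and sz :: "nat \<Rightarrow> nat" and V :: "nat \<Rightarrow> nat \<Rightarrow> real vec" and pr :: "nat \<Rightarrow> nat \<Rightarrow> real"
begin

text \<open>
  \<open>path_sum j P i\<close> is the total signed weight of the sequences \<open>i < i\<^sub>1 < \<dots> < i\<^sub>j \<le> m\<close> of indices, with a
  support vector for each of them, when the vectors are orthogonalised starting from \<open>P\<close>.
\<close>
definition level_step :: "(real mat \<Rightarrow> nat \<Rightarrow> real) \<Rightarrow> real mat \<Rightarrow> nat \<Rightarrow> real" where
  "level_step F P i = (\<Sum>i' = i+1..m. \<Sum>a<sz i'.
     - (pr i' a * (V i' a \<bullet> (P *\<^sub>v V i' a))) * F (deflate P (V i' a)) i')"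

fun path_sum :: "nat \<Rightarrow> real mat \<Rightarrow> nat \<Rightarrow> real" where
  "path_sum 0 = (\<lambda>_ _. 1)"
| "path_sum (Suc j) = level_step (path_sum j)"

text \<open>Only \<open>m - i\<close> indices lie above \<open>i\<close> and up to \<open>m\<close>,
  so no increasing sequence of length \<open>j\<close> fits.\<close>

lemma path_sum_eq_0: "j > m - i \<Longrightarrow> path_sum j P i = 0"
proof (induction j arbitrary: P i)
  case (Suc j)
  have "path_sum j Q i' = 0" if "i' \<in> {i+1..m}" for i' Q
    using that Suc.prems by (intro Suc.IH) auto
  then show ?case by (simp add: level_step_def)
qed simp

text \<open>Sequences that skip the index \<open>i + 1\<close> are separated from those that start
  with it.\<close>

lemma path_sum_rec:
  assumes "i < m"
  shows "path_sum (Suc j) P i = path_sum (Suc j) P (i+1) +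
    (\<Sum>a<sz (i+1). - (pr (i+1) a * (V (i+1) a \<bullet> (P *\<^sub>v V (i+1) a))) * path_sum j
        (deflate P (V (i+1) a)) (i+1))"
  using assms by (simp add: level_step_def sum.atLeast_Suc_atMost[of "Suc i" m])

text \<open>In the generating function in \<open>y\<close>, choosing the index \<open>i + 1\<close>
  lowers the remaining length by one and so pulls out a factor \<open>y\<close>. The expected
  determinant will obey the same recursion.\<close>

lemma path_gf_rec:
  assumes "i < m"
  shows "(\<Sum>j\<le>m-i. y^j * path_sum j P i) = (\<Sum>j\<le>m-(i+1). y^j * path_sum j P (i+1)) +
    (\<Sum>a<sz (i+1). pr (i+1) a * (- y * (V (i+1) a \<bullet> (P *\<^sub>v V (i+1) a)) *
       (\<Sum>j\<le>m-(i+1). y^j * path_sum j (deflate P (V (i+1) a)) (i+1))))" (is "?L = ?A + ?B")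
proof -
  have mi: "m - i = Suc (m - (i+1))" using assms by simp
  have A: "?A = 1 + (\<Sum>j\<le>m-(i+1). y^Suc j * path_sum (Suc j) P (i+1))"
  proof -
    \<comment> \<open>The added top term is zero; both sides now have the same range of
      exponents.\<close>
    have "?A = (\<Sum>j\<le>m-i. y^j * path_sum j P (i+1))"
      unfolding mi using path_sum_eq_0[of "i+1" "Suc (m-(i+1))" P] by simp
    also have "\<dots> = 1 + (\<Sum>j\<le>m-(i+1). y^Suc j * path_sum (Suc j) P (i+1))"
      unfolding mi by (subst sum.atMost_Suc_shift) simp
    finally show ?thesis .
  qed
  have "?L = 1 + (\<Sum>j\<le>m-(i+1). y^Suc j * path_sum (Suc j) P i)"
    unfolding mi by (subst sum.atMost_Suc_shift) simp
  also have "(\<Sum>j\<le>m-(i+1). y^Suc j * path_sum (Suc j) P i) =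
     (\<Sum>j\<le>m-(i+1). y^Suc j * path_sum (Suc j) P (i+1)) + (\<Sum>j\<le>m-(i+1). \<Sum>a<sz (i+1).
      pr (i+1) a * (- y * (V (i+1) a \<bullet> (P *\<^sub>v V (i+1) a)) *
          (y^j * path_sum j (deflate P (V (i+1) a)) (i+1))))"
    unfolding path_sum_rec[OF assms] distrib_left sum.distrib sum_distrib_left
    by (simp add: algebra_simps)
  also have "(\<Sum>j\<le>m-(i+1). \<Sum>a<sz (i+1).
      pr (i+1) a * (- y * (V (i+1) a \<bullet> (P *\<^sub>v V (i+1) a)) *
          (y^j * path_sum j (deflate P (V (i+1) a)) (i+1)))) = ?B"
    by (subst sum.swap) (simp add: sum_distrib_left)
  finally show ?thesis unfolding A by simp
qed

end

section \<open>Expectation over independent, finitely supported vectors\<close>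

definition outer_sum_from :: "nat \<Rightarrow> nat \<Rightarrow> nat \<Rightarrow> (nat \<Rightarrow> real vec) \<Rightarrow> real mat" where
  "outer_sum_from n i m v = Matrix.mat n n (\<lambda>ab. \<Sum>i' = i+1..m. outer (v i') $$ ab)"

lemma outer_sum_from_carrier [simp]: "outer_sum_from n i m v \<in> carrier_mat n n"
  by (simp add: outer_sum_from_def)

lemma outer_sum_from_rec:
  assumes "i < m" "v (i+1) \<in> carrier_vec n"
  shows "c \<cdot>\<^sub>m outer_sum_from n i m v = c \<cdot>\<^sub>m outer_sum_from n (i+1) m v + c \<cdot>\<^sub>m outer (v (i+1))"
  by (rule eq_matI) (use assms in \<open>auto simp: outer_sum_from_def outer_def
      sum.atLeast_Suc_atMost[of "Suc i" m] algebra_simps\<close>)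

lemma sum_set_distinct_nth:
  "distinct xs \<Longrightarrow> (\<Sum>x\<in>set xs. f x) = (\<Sum>a<length xs. f (xs ! a))"
  by (simp add: sum.distinct_set_conv_list sum_list_sum_nth lessThan_atLeast0)

lemma finite_set_Pi_pmf:
  assumes "finite A" "\<And>i. i \<in> A \<Longrightarrow> finite (set_pmf (p i))"
  shows "finite (set_pmf (Pi_pmf A d p))"
  using assms by (auto simp: set_Pi_pmf intro!: finite_PiE_dflt)

context
  fixes n m l :: nat and p :: "nat \<Rightarrow> real vec pmf" and S :: "nat \<Rightarrow> real vec list" and r ::
      "nat \<Rightarrow> real vec"
begin

text \<open>A fixed vector is treated as a random vector with a single value.\<close>
definition eff_size :: "nat \<Rightarrow> nat" where "eff_size i = (if i \<le> l then 1 else length (S i))"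

definition eff_vec :: "nat \<Rightarrow> nat \<Rightarrow> real vec" where
  "eff_vec i a = (if i \<le> l then r i else S i ! a)"

definition eff_prob :: "nat \<Rightarrow> nat \<Rightarrow> real" where
  "eff_prob i a = (if i \<le> l then 1 else pmf (p i) (S i ! a))"

context
  assumes supp: "\<forall>i\<in>{1..m}. finite (set_pmf (p i)) \<and> set_pmf (p i) \<subseteq> carrier_vec n \<and>
                   distinct (S i) \<and> set (S i) = set_pmf (p i)"
    and l: "l \<le> m" and r: "\<forall>i\<in>{1..l}. r i \<in> set_pmf (p i)"
begin

text \<open>Downward induction on \<open>i\<close>: each step splits off the vector with index
  \<open>i + 1\<close> and reproduces the recursion of \<open>path_gf_rec\<close>. The projection
  stays arbitrary because the hypothesis is applied to \<open>P\<close> and to its deflations. The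
  product measure starts at \<open>max i l + 1\<close> because indices up to \<open>l\<close> carry
  no randomness.\<close>

lemma expected_det_eq_path_sum:
  assumes "i \<le> m" "is_proj n P"
  shows "measure_pmf.expectation (Pi_pmf {max i l+1..m} (0\<^sub>v n) p)
       (\<lambda>\<omega>. det (1\<^sub>m n + ((- y) \<cdot>\<^sub>m outer_sum_from n i m (\<lambda>i. if i \<le> l then r i else \<omega> i)) * P))
     = (\<Sum>j\<le>m-i. y^j * path_sum m eff_size eff_vec eff_prob j P i)"
  using assms
proof (induction arbitrary: P rule: inc_induct)
  case base
  have "outer_sum_from n m m v = 0\<^sub>m n n" for v
    by (rule eq_matI) (auto simp: outer_sum_from_def)
  moreover have "P \<in> carrier_mat n n" using base by (simp add: is_proj_def)
  ultimately show ?case by simp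
next
  case (step i)
  let ?g = "\<lambda>\<omega> i'. if i' \<le> l then r i' else \<omega> i' :: real vec"
  let ?D = "\<lambda>i P \<omega>. det (1\<^sub>m n + ((- y) \<cdot>\<^sub>m outer_sum_from n i m (?g \<omega>)) * P)"
  let ?M = "\<lambda>i. Pi_pmf {max i l+1..m} (0\<^sub>v n) p"
  let ?X = "\<lambda>P. \<Sum>j\<le>m-(i+1). y^j * path_sum m eff_size eff_vec eff_prob j P (i+1)"
  have IH: "measure_pmf.expectation (?M (i+1)) (?D (i+1) P) = ?X P" if "is_proj n P" for P
    using step.IH[OF that] by simp
  have fin: "finite (set_pmf (?M i))" for i
    by (rule finite_set_Pi_pmf) (use supp in auto)
  have int: "integrable (measure_pmf (?M i)) f" for i and f :: "_ \<Rightarrow> real"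
    by (rule integrable_measure_pmf_finite[OF fin])
  \<comment> \<open>The deflation identity with \<open>c = - y\<close>, pointwise in the
    outcome.\<close>
  have pt: "?D i P \<omega> = ?D (i+1) P \<omega> - y * (v \<bullet> (P *\<^sub>v v)) * ?D (i+1) (deflate P v) \<omega>"
    if "?g \<omega> (i+1) = v" "v \<in> carrier_vec n" for \<omega> v
  proof -
    have "(- y) \<cdot>\<^sub>m outer_sum_from n i m (?g \<omega>)
        = (- y) \<cdot>\<^sub>m outer_sum_from n (i+1) m (?g \<omega>) + (- y) \<cdot>\<^sub>m outer v"
      using outer_sum_from_rec[of i m "?g \<omega>" n "- y"] step.hyps that by simp
    then show ?thesis
      using det_plus_outer_mult_proj[OF step.prems that(2),
          of "(- y) \<cdot>\<^sub>m outer_sum_from n (i+1) m (?g \<omega>)" "- y"]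
      by simp
  qed
  have E: "measure_pmf.expectation (?M (i+1))
      (\<lambda>\<omega>. ?D (i+1) P \<omega> - y * (v \<bullet> (P *\<^sub>v v)) * ?D (i+1) (deflate P v) \<omega>)
      = ?X P + (- y * (v \<bullet> (P *\<^sub>v v)) * ?X (deflate P v))" if "v \<in> carrier_vec n" for v
    using IH[OF step.prems] IH[OF is_proj_deflate[OF step.prems that]]
    by (subst Bochner_Integration.integral_diff[OF int int]) simp
  have main: "measure_pmf.expectation (?M i) (?D i P) = ?X P +
      (\<Sum>a<eff_size (i+1). eff_prob (i+1) a *
       (- y * (eff_vec (i+1) a \<bullet> (P *\<^sub>v eff_vec (i+1) a)) * ?X (deflate P (eff_vec (i+1) a))))"
  proof (cases "i < l")
    \<comment> \<open>Index \<open>i + 1\<close> is fixed: the product measure is the same for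
      \<open>i\<close> and \<open>i + 1\<close>, and the sum over \<open>a\<close> has a single term
      of probability 1.\<close>
    case True
    have v: "r (i+1) \<in> carrier_vec n" using True r supp l by force
    have "max i l = max (i+1) l" using True by simp
    then have "measure_pmf.expectation (?M i) (?D i P) =
        measure_pmf.expectation (?M (i+1)) (?D i P)"
      by simp
    moreover have "?D i P = (\<lambda>\<omega>. ?D (i+1) P \<omega> - y * (r (i+1) \<bullet> (P *\<^sub>v r (i+1))) *
        ?D (i+1) (deflate P (r (i+1))) \<omega>)"
      by (rule ext, rule pt) (use True v in auto)
    ultimately show ?thesis using E[OF v] True by (simp add: eff_size_def eff_vec_def eff_prob_def)
  next
    case False
    then have mx: "max i l = i" "max (i+1) l = i+1" by auto
    have "{i+1..m} = insert (i+1) {i+1+1..m}" using step.hyps by auto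
    \<comment> \<open>By independence, coordinate \<open>i + 1\<close> can be drawn separately from
      the others.\<close>
    then have M: "?M i = p (i+1) \<bind> (\<lambda>a. ?M (i+1) \<bind> (\<lambda>f. return_pmf (f(i+1 := a))))"
      unfolding mx by (metis Pi_pmf_insert' finite_atLeastAtMost atLeastAtMost_iff Suc_eq_plus1
          Suc_n_not_le_n)
    have s: "finite (set_pmf (p (i+1)))" "set_pmf (p (i+1)) \<subseteq> carrier_vec n" "distinct (S (i+1))"
        "set (S (i+1)) = set_pmf (p (i+1))"
      using supp step.hyps by auto
    have inner: "measure_pmf.expectation (?M (i+1) \<bind> (\<lambda>f. return_pmf (f(i+1 := a)))) (?D i P)
       = ?X P + (- y * (a \<bullet> (P *\<^sub>v a)) * ?X (deflate P a))" if "a \<in> set_pmf (p (i+1))" for a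
    proof -
      have a: "a \<in> carrier_vec n" using that s by auto
      have "measure_pmf.expectation (?M (i+1) \<bind> (\<lambda>f. return_pmf (f(i+1 := a)))) (?D i P)
        = measure_pmf.expectation (?M (i+1)) (\<lambda>f. ?D i P (f(i+1 := a)))"
        by (simp only: map_pmf_def[symmetric] integral_map_pmf)
      also have "(\<lambda>f. ?D i P (f(i+1 := a))) =
         (\<lambda>f. ?D (i+1) P f - y * (a \<bullet> (P *\<^sub>v a)) * ?D (i+1) (deflate P a) f)"
      proof
        fix f :: "nat \<Rightarrow> real vec"
        \<comment> \<open>This tail starts at index \<open>i + 2\<close>, so the drawn coordinate
          does not enter.\<close>
        have "outer_sum_from n (i+1) m (?g (f(i+1 := a))) = outer_sum_from n (i+1) m (?g f)"
          unfolding outer_sum_from_def by (rule cong_mat) (auto intro!: sum.cong)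
        then show "?D i P (f(i+1 := a)) = ?D (i+1) P f - y * (a \<bullet> (P *\<^sub>v a)) *
            ?D (i+1) (deflate P a) f"
          using pt[of "f(i+1 := a)" a] False a by simp
      qed
      also note E[OF a]
      finally show ?thesis .
    qed
    have "measure_pmf.expectation (?M i) (?D i P) = (\<Sum>a\<in>set_pmf (p (i+1)). pmf (p (i+1)) a *
        measure_pmf.expectation (?M (i+1) \<bind> (\<lambda>f. return_pmf (f(i+1 := a)))) (?D i P))"
      unfolding M by (subst pmf_expectation_bind[of "set_pmf (p (i+1))"])
          (use s fin[of "i+1"] in auto)
    also have "\<dots> = (\<Sum>a\<in>set_pmf (p (i+1)). pmf (p (i+1)) a *
        (?X P + (- y * (a \<bullet> (P *\<^sub>v a)) * ?X (deflate P a))))"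
      by (rule sum.cong) (auto simp only: inner)
    also have "\<dots> = (\<Sum>a\<in>set_pmf (p (i+1)). pmf (p (i+1)) a) * ?X P
        + (\<Sum>a\<in>set_pmf (p (i+1)). pmf (p (i+1)) a * (- y * (a \<bullet> (P *\<^sub>v a)) * ?X (deflate P a)))"
      by (simp only: distrib_left sum.distrib sum_distrib_right)
    \<comment> \<open>The weights in front of the sequences that skip \<open>i + 1\<close>.\<close>
    also have "(\<Sum>a\<in>set_pmf (p (i+1)). pmf (p (i+1)) a) = 1"
      by (rule sum_pmf_eq_1) (use s in auto)
    also have "(\<Sum>a\<in>set_pmf (p (i+1)). pmf (p (i+1)) a * (- y * (a \<bullet> (P *\<^sub>v a)) * ?X (deflate P a)))
       = (\<Sum>a<eff_size (i+1). eff_prob (i+1) a *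
       (- y * (eff_vec (i+1) a \<bullet> (P *\<^sub>v eff_vec (i+1) a)) * ?X (deflate P (eff_vec (i+1) a))))"
      unfolding s(4)[symmetric] sum_set_distinct_nth[OF s(3)] using False
      by (simp add: eff_size_def eff_vec_def eff_prob_def)
    finally show ?thesis by simp
  qed
  show ?case unfolding path_gf_rec[OF step.hyps(2)] using main by simp
qed

text \<open>Substituting \<open>x = 1 / y\<close> and multiplying by \<open>y ^ n\<close> reverses
  the expected characteristic polynomial. The result is the expected determinant for
  \<open>i = 0\<close> and the identity projection, which is the generating function of the path
  sums; coefficients are then compared.\<close>

lemma top_coeffs_path_sum:
  assumes "k \<le> n" and out: "\<And>j. j \<in> {1..k} \<Longrightarrow> out j =
      path_sum m eff_size eff_vec eff_prob j (1\<^sub>m n) 0"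
  shows "top_coeffs n k (expected_charpoly n m p l r) out"
proof -
  let ?H = "\<lambda>j. path_sum m eff_size eff_vec eff_prob j (1\<^sub>m n) 0"
  let ?M = "Pi_pmf {l+1..m} (0\<^sub>v n) p"
  let ?A = "\<lambda>\<omega>. outer_sum n m (\<lambda>i. if i \<le> l then r i else \<omega> i)"
  have A: "?A \<omega> \<in> carrier_mat n n" for \<omega> by (simp add: outer_sum_def)
  have fin: "finite (set_pmf ?M)"
    by (rule finite_set_Pi_pmf) (use supp in auto)
  \<comment> \<open>The joint support is finite, so the expectation of the characteristic
    polynomials is itself a polynomial.\<close>
  define F where "F = (\<Sum>\<omega>\<in>set_pmf ?M. Polynomial.smult (pmf ?M \<omega>) (char_poly (?A \<omega>)))"
  have charpoly: "det (x \<cdot>\<^sub>m 1\<^sub>m n - ?A \<omega>) = poly (char_poly (?A \<omega>)) x" for x \<omega>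
    unfolding char_poly_matrix[OF A]
    by (rule arg_cong[of _ _ det]) (auto intro!: eq_matI simp: char_matrix_def outer_sum_def)
  have f: "expected_charpoly n m p l r x = poly F x" for x
    unfolding expected_charpoly_def charpoly
    by (subst integral_measure_pmf[OF fin]) (auto simp: F_def poly_sum)
  have deg: "degree F \<le> n"
    unfolding F_def by (rule degree_sum_le[OF fin])
        (use degree_monic_char_poly[OF A] in \<open>auto intro: order.trans[OF degree_smult_le]\<close>)
  have pF: "poly F x = (\<Sum>i\<le>n. coeff F i * x ^ i)" for x
    by (subst poly_as_sum_of_monoms'[OF deg, symmetric]) (simp add: poly_sum poly_monom)
  have lead: "coeff F n = 1"
  proof -
    have "coeff (char_poly (?A \<omega>)) n = 1" for \<omega> using degree_monic_char_poly[OF A[of \<omega>]] by auto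
    then have "coeff F n = (\<Sum>\<omega>\<in>set_pmf ?M. pmf ?M \<omega>)" by (simp add: F_def coeff_sum)
    also have "\<dots> = 1" using fin by (intro sum_pmf_eq_1) auto
    finally show ?thesis .
  qed
  have "is_proj n (1\<^sub>m n)" by (simp add: is_proj_def)
  note E = expected_det_eq_path_sum[OF le0 this, simplified]
  have inv: "expected_charpoly n m p l r (1 / y) * y ^ n = (\<Sum>j\<le>m. y^j * ?H j)" if "y \<noteq> 0" for y
  proof -
    have "det ((1 / y) \<cdot>\<^sub>m 1\<^sub>m n - ?A \<omega>) * y ^ n
       = det (1\<^sub>m n + (- y) \<cdot>\<^sub>m outer_sum_from n 0 m (\<lambda>i. if i \<le> l then r i else \<omega> i) * 1\<^sub>m n)" (is "_
           = det ?B") for \<omega>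
    proof -
      have "?B = y \<cdot>\<^sub>m ((1 / y) \<cdot>\<^sub>m 1\<^sub>m n - ?A \<omega>)"
        using that by (subst right_mult_one_mat[where nr=n])
          (auto intro!: eq_matI simp: outer_sum_from_def outer_sum_def right_diff_distrib)
      moreover have "dim_col (?A \<omega>) = n" by (simp add: outer_sum_def)
      ultimately show ?thesis by simp
    qed
    then have "expected_charpoly n m p l r (1 / y) * y ^ n = measure_pmf.expectation ?M
       (\<lambda>\<omega>. det (1\<^sub>m n + (- y) \<cdot>\<^sub>m outer_sum_from n 0 m (\<lambda>i. if i \<le> l then r i else \<omega> i) * 1\<^sub>m n))"
      unfolding expected_charpoly_def
      by (simp only: Bochner_Integration.integral_mult_left_zero[symmetric])
    then show ?thesis using E by simp
  qed
  have eq: "(\<Sum>j\<le>n. coeff F (n - j) * y ^ j) = (\<Sum>j\<le>m. y^j * ?H j)" if "y \<noteq> 0" for y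
  proof -
    have "poly F (1/y) * y ^ n = (\<Sum>i\<le>n. coeff F i * (1/y)^i * y ^ n)"
      by (simp add: pF sum_distrib_right)
    also have "\<dots> = (\<Sum>i\<le>n. coeff F i * y ^ (n - i))"
      using that by (intro sum.cong) (auto simp: power_diff field_simps)
    also have "\<dots> = (\<Sum>j\<le>n. coeff F (n - j) * y ^ j)"
      by (rule sum.reindex_bij_witness[of _ "\<lambda>j. n - j" "\<lambda>j. n - j"]) auto
    finally show ?thesis using f inv[OF that] by simp
  qed
  define G1 where "G1 = (\<Sum>j\<le>n. monom (coeff F (n - j)) j)"
  define G2 where "G2 = (\<Sum>j\<le>m. monom (?H j) j)"
  \<comment> \<open>The identity is known for nonzero \<open>y\<close> only; multiplication by the
    indeterminate makes it hold at 0 too.\<close>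
  have "poly (pCons 0 (G1 - G2)) y = 0" for y
    using eq[of y] by (cases "y = 0") (auto simp: G1_def G2_def poly_sum poly_monom mult.commute)
  then have "pCons 0 (G1 - G2) = 0" using poly_all_0_iff_0 by blast
  then have "G1 = G2" by simp
  have co: "coeff F (n - j) = ?H j" if "j \<le> n" for j
  proof -
    have "coeff F (n - j) = coeff G1 j" using that by (simp add: G1_def coeff_sum coeff_monom)
    also have "\<dots> = (if j \<le> m then ?H j else 0)" unfolding \<open>G1 = G2\<close>
        by (simp add: G2_def coeff_sum coeff_monom)
    also have "\<dots> = ?H j" by (simp add: path_sum_eq_0)
    finally show ?thesis .
  qed
  have "expected_charpoly n m p l r x = x ^ n + (\<Sum>j = 1..n. coeff F (n - j) * x ^ (n - j))" for x
  proof -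
    have "expected_charpoly n m p l r x = (\<Sum>i\<le>n. coeff F i * x ^ i)"
      using f pF by simp
    also have "\<dots> = (\<Sum>j\<le>n. coeff F (n - j) * x ^ (n - j))"
      by (rule sum.reindex_bij_witness[of _ "\<lambda>j. n - j" "\<lambda>j. n - j"]) auto
    also have "\<dots> = x ^ n + (\<Sum>j = 1..n. coeff F (n - j) * x ^ (n - j))"
      using lead by (simp add: atMost_atLeast0 sum.atLeast_Suc_atMost[of 0 n])
    finally show ?thesis .
  qed
  moreover have "out j = coeff F (n - j)" if "j \<in> {1..k}" for j
    using that out co assms(1) by auto
  ultimately show ?thesis unfolding top_coeffs_def by (intro exI[of _ "\<lambda>j. coeff F (n - j)"]) auto
qed

end

end

section \<open>Timed Hoare rules\<close>

definition runs :: "com \<Rightarrow> state \<Rightarrow> nat \<Rightarrow> (state \<Rightarrow> bool) \<Rightarrow> bool" where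
  "runs c s T Q \<longleftrightarrow> (\<exists>t s'. exec c s t s' \<and> t \<le> T \<and> Q s')"

notation Seq (infixr ";;" 60)

abbreviation nvar :: "string \<Rightarrow> nexp" where "nvar x \<equiv> NGet x []"

lemma runs_mono: "runs c s T Q \<Longrightarrow> T \<le> T' \<Longrightarrow> (\<And>s'. Q s' \<Longrightarrow> Q' s') \<Longrightarrow> runs c s T' Q'"
  unfolding runs_def using order.trans by blast

text \<open>The second program gets the budget that the first leaves; \<open>T1 \<le> T\<close>
  keeps the truncated difference meaningful.\<close>

lemma runs_Seq:
  assumes "runs c s T1 Q1" "T1 \<le> T" "\<And>s'. Q1 s' \<Longrightarrow> runs d s' (T - T1) Q"
  shows "runs (c ;; d) s T Q"
proof -
  obtain t1 s1 where 1: "exec c s t1 s1" "t1 \<le> T1" "Q1 s1" using assms(1) by (auto simp: runs_def)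
  obtain t2 s2 where 2: "exec d s1 t2 s2" "t2 \<le> T - T1" "Q s2" using assms(3)[OF 1(3)]
      by (auto simp: runs_def)
  show ?thesis unfolding runs_def using exec.Seq[OF 1(1) 2(1)] 1(2) 2(2,3) assms(2)
    by (intro exI[of _ "t1 + t2"] exI[of _ s2]) auto
qed

lemma runs_NAssign:
  assumes "1 + sum_list (map ncost es) + ncost e \<le> T"
      "Q (nwrite x (map (\<lambda>e. nval e s) es) (nval e s) s)"
  shows "runs (NAssign x es e) s T Q"
  using exec.NAssign assms unfolding runs_def by blast

lemma runs_RAssign:
  assumes "1 + sum_list (map ncost es) + rcost e \<le> T"
      "Q (rwrite x (map (\<lambda>e. nval e s) es) (rval e s) s)"
  shows "runs (RAssign x es e) s T Q"
  using exec.RAssign assms unfolding runs_def by blast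

lemma runs_NAssign_Seq:
  assumes "1 + sum_list (map ncost es) + ncost e \<le> T"
    "runs d (nwrite x (map (\<lambda>e. nval e s) es) (nval e s) s)
        (T - (1 + sum_list (map ncost es) + ncost e)) Q"
  shows "runs (NAssign x es e ;; d) s T Q"
  by (rule runs_Seq[OF runs_NAssign[OF order.refl,
      where Q="\<lambda>s'. s' = nwrite x (map (\<lambda>e. nval e s) es) (nval e s) s"]])
    (use assms in auto)

lemma runs_RAssign_Seq:
  assumes "1 + sum_list (map ncost es) + rcost e \<le> T"
    "runs d (rwrite x (map (\<lambda>e. nval e s) es) (rval e s) s)
        (T - (1 + sum_list (map ncost es) + rcost e)) Q"
  shows "runs (RAssign x es e ;; d) s T Q"
  by (rule runs_Seq[OF runs_RAssign[OF order.refl,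
      where Q="\<lambda>s'. s' = rwrite x (map (\<lambda>e. nval e s) es) (rval e s) s"]])
    (use assms in auto)

section \<open>Counting loops\<close>

definition for_loop :: "string \<Rightarrow> nexp \<Rightarrow> nexp \<Rightarrow> com \<Rightarrow> com" where
  "for_loop x e0 e1 body = NAssign x [] e0 ;;
     While (NLess (nvar x) e1) (body ;; NAssign x [] (NAdd (nvar x) (NConst 1)))"

lemma mem_write [simp]:
  "nmem (nwrite x a v s) = (nmem s)(x := (nmem s x)(a := v))"
  "rmem (nwrite x a v s) = rmem s"
  "rmem (rwrite x a y s) = (rmem s)(x := (rmem s x)(a := y))"
  "nmem (rwrite x a y s) = nmem s"
  by (simp_all add: nwrite_def rwrite_def)

text \<open>A round costs \<open>T\<close> for the body, \<open>ncost e1 + 3\<close> for the test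
  and 4 for the increment. The bound \<open>e1\<close> is evaluated anew before every round, so the
  invariant has to fix its value. \<open>max i B\<close> covers a loop without rounds.\<close>

lemma runs_while_up:
  assumes step: "\<And>i s. A \<le> i \<Longrightarrow> i < B \<Longrightarrow> I i s \<Longrightarrow> nmem s x [] = i \<Longrightarrow>
       runs body s T (\<lambda>s'. nmem s' x [] = i \<and> I (Suc i) (nwrite x [] (Suc i) s'))"
    and bnd: "\<And>i s. I i s \<Longrightarrow> nmem s x [] = i \<Longrightarrow> nval e1 s = B"
    and "A \<le> i" "I i s" "nmem s x [] = i"
  shows "runs (While (NLess (nvar x) e1) (body ;; NAssign x [] (NAdd (nvar x) (NConst 1)))) s
     ((B - i) * (T + ncost e1 + 7) + ncost e1 + 3) (\<lambda>s'. I (max i B) s')"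
  using assms(3-5)
proof (induction "B - i" arbitrary: i s)
  case 0
  have e1: "nval e1 s = B" by (rule bnd[OF 0(3,4)])
  then have "\<not> bval (NLess (nvar x) e1) s" using 0(1,4) by simp
  note ex = exec.WhileFalse[OF this]
  have "max i B = i" using 0(1) by simp
  moreover have "1 + bcost (NLess (nvar x) e1) \<le> (B - i) * (T + ncost e1 + 7) + ncost e1 + 3"
      by simp
  ultimately show ?case unfolding runs_def using ex 0(3) by metis
next
  case (Suc k)
  have iB: "i < B" using Suc(2) by simp
  have e1: "nval e1 s = B" by (rule bnd[OF Suc(4,5)])
  have b: "bval (NLess (nvar x) e1) s" using e1 Suc(5) iB by simp
  obtain t1 s1 where 1: "exec body s t1 s1" "t1 \<le> T" "nmem s1 x [] = i"
      "I (Suc i) (nwrite x [] (Suc i) s1)"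
    using step[OF Suc(3) iB Suc(4,5)] by (auto simp: runs_def)
  let ?s2 = "nwrite x [] (Suc i) s1"
  have 2: "exec (NAssign x [] (NAdd (nvar x) (NConst 1))) s1 4 ?s2"
    using exec.NAssign[of x "[]" "NAdd (nvar x) (NConst 1)" s1] 1(3) by (simp add: eval_nat_numeral)
  have "runs (While (NLess (nvar x) e1) (body ;; NAssign x [] (NAdd (nvar x) (NConst 1)))) ?s2
     ((B - Suc i) * (T + ncost e1 + 7) + ncost e1 + 3) (\<lambda>s'. I (max (Suc i) B) s')"
    by (rule Suc(1)[OF _ _ 1(4)]) (use Suc(2,3) in simp_all)
  moreover have "max (Suc i) B = max i B" using iB by simp
  ultimately obtain t3 s3 where 3:
     "exec (While (NLess (nvar x) e1) (body ;; NAssign x [] (NAdd (nvar x) (NConst 1)))) ?s2 t3 s3"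
     "t3 \<le> (B - Suc i) * (T + ncost e1 + 7) + ncost e1 + 3" "I (max i B) s3"
         by (auto simp: runs_def)
  have "B - i = Suc (B - Suc i)" using iB by simp
  then have "1 + bcost (NLess (nvar x) e1) + (t1 + 4) + t3 \<le> (B - i) * (T + ncost e1 + 7) +
      ncost e1 + 3"
    using 1(2) 3(2) by simp
  then show ?case unfolding runs_def
    using exec.WhileTrue[OF b exec.Seq[OF 1(1) 2] 3(1)] 3(3) by blast
qed

lemma runs_for_loop:
  assumes e0: "nval e0 s = A" and init: "I A (nwrite x [] A s)"
    and step: "\<And>i s. A \<le> i \<Longrightarrow> i < B \<Longrightarrow> I i s \<Longrightarrow> nmem s x [] = i \<Longrightarrow>
       runs body s T (\<lambda>s'. nmem s' x [] = i \<and> I (Suc i) (nwrite x [] (Suc i) s'))"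
    and bnd: "\<And>i s. I i s \<Longrightarrow> nmem s x [] = i \<Longrightarrow> nval e1 s = B"
    and post: "\<And>s. I (max A B) s \<Longrightarrow> Q s"
    and T': "(B - A) * (T + ncost e1 + 7) + ncost e1 + ncost e0 + 4 \<le> T'"
  shows "runs (for_loop x e0 e1 body) s T' Q"
  unfolding for_loop_def
proof (rule runs_NAssign_Seq)
  show "1 + sum_list (map ncost []) + ncost e0 \<le> T'" using T' by simp
  have *: "runs (While (NLess (nvar x) e1) (body ;; NAssign x [] (NAdd (nvar x) (NConst 1))))
      (nwrite x [] A s)
     ((B - A) * (T + ncost e1 + 7) + ncost e1 + 3) (\<lambda>s'. I (max A B) s')"
    by (rule runs_while_up[OF step bnd order.refl init]) simp_all
  have "runs (While (NLess (nvar x) e1) (body ;; NAssign x [] (NAdd (nvar x) (NConst 1))))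
      (nwrite x [] A s)
     (T' - (1 + ncost e0)) Q"
    by (rule runs_mono[OF * _ post]) (use T' in simp_all)
  then show "runs (While (NLess (nvar x) e1) (body ;; NAssign x [] (NAdd (nvar x) (NConst 1))))
     (nwrite x (map (\<lambda>e. nval e s) []) (nval e0 s) s)
         (T' - (1 + sum_list (map ncost []) + ncost e0)) Q"
    using e0 by simp
qed

definition frame :: "string set \<Rightarrow> string set \<Rightarrow> state \<Rightarrow> state \<Rightarrow> bool" where
  "frame X Y s s' \<longleftrightarrow> (\<forall>x. x \<notin> X \<longrightarrow> nmem s' x = nmem s x) \<and> (\<forall>y. y \<notin> Y \<longrightarrow> rmem s' y = rmem s y)"

section \<open>The children of a node\<close>

text \<open>
  Node \<open>q\<close> of level \<open>j\<close> has the matrix \<open>P[j,q,_,_]\<close>, the weight \<open>w[j,q]\<close> and the last index \<open>last[j,q]\<close>;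
  level \<open>j\<close> has \<open>cnt[j]\<close> nodes.  The next child, on level \<open>j + 1\<close>, gets number \<open>N\<close>.
\<close>
definition dot_prog :: com where
  "dot_prog = for_loop ''c'' (NConst 0) (nvar ''n'')
     (RAssign ''u'' [nvar ''b''] (RAdd (RGet ''u'' [nvar ''b''])
       (RMul (RGet ''P'' [nvar ''j'', nvar ''q'', nvar ''b'', nvar ''c''])
             (RGet ''supp'' [nvar ''i'', nvar ''a'', nvar ''c'']))))"

lemma runs_dot_prog:
  assumes s: "nmem s ''n'' [] = n" "nmem s ''j'' [] = j" "nmem s ''q'' [] = q"
      "nmem s ''i'' [] = i" "nmem s ''a'' [] = a"
    "nmem s ''b'' [] = b" "rmem s ''u'' [b] = 0"
  shows "runs dot_prog s (n * 30 + 6) (frame {''c''} {}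
    (rwrite ''u'' [b] (\<Sum>c<n. rmem s ''P'' [j, q, b, c] * rmem s ''supp'' [i, a, c]) s))"
  unfolding dot_prog_def
\<comment> \<open>The assignment costs 15 steps; 22 is chosen so that a round with its overhead
  costs 30.\<close>
proof (rule runs_for_loop[where A=0 and B=n and T=22 and I="\<lambda>c. frame {''c''} {}
    (rwrite ''u'' [b] (\<Sum>c<c. rmem s ''P'' [j, q, b, c] * rmem s ''supp'' [i, a, c]) s)"],
        goal_cases)
  case (3 c s1)
  show ?case by (rule runs_RAssign) (use s 3 in \<open>simp_all add: frame_def fun_eq_iff\<close>)
qed (use s in \<open>auto simp: frame_def fun_eq_iff\<close>)

text \<open>With \<open>P\<close> the matrix of node \<open>q\<close> and \<open>v\<close> the
  support vector \<open>a\<close> of index \<open>i\<close>, this leaves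
  \<open>P *\<^sub>v v\<close> in \<open>u\<close> and its scalar product with \<open>v\<close> in
  \<open>d\<close>.\<close>

definition apply_prog :: com where
  "apply_prog = for_loop ''b'' (NConst 0) (nvar ''n'')
     (RAssign ''u'' [nvar ''b''] (RConst 0) ;; dot_prog ;;
      RAssign ''d'' [] (RAdd (RGet ''d'' [])
        (RMul (RGet ''u'' [nvar ''b'']) (RGet ''supp'' [nvar ''i'', nvar ''a'', nvar ''b'']))))"

lemma runs_apply_prog:
  assumes s: "nmem s ''n'' [] = n" "nmem s ''j'' [] = j" "nmem s ''q'' [] = q"
      "nmem s ''i'' [] = i" "nmem s ''a'' [] = a"
    "rmem s ''d'' [] = 0"
  defines "pv \<equiv> \<lambda>b. \<Sum>c<n. rmem s ''P'' [j, q, b, c] * rmem s ''supp'' [i, a, c]"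
  shows "runs apply_prog s (n * (n * 30 + 50) + 10) (\<lambda>s'. frame {''b'', ''c''} {''u'', ''d''} s s' \<and>
     (\<forall>b<n. rmem s' ''u'' [b] = pv b) \<and> rmem s' ''d'' [] =
         (\<Sum>b<n. pv b * rmem s ''supp'' [i, a, b]))"
  unfolding apply_prog_def
proof (rule runs_for_loop[where A=0 and B=n and T="n * 30 + 30"
    and I="\<lambda>b s'. frame {''b'', ''c''} {''u'', ''d''} s s' \<and>
     (\<forall>b'<b. rmem s' ''u'' [b'] = pv b') \<and> rmem s' ''d'' [] =
         (\<Sum>b'<b. pv b' * rmem s ''supp'' [i, a, b'])"], goal_cases)
  case (3 b s1)
  let ?s2 = "rwrite ''u'' [b] 0 s1"
  have s1: "nmem s1 ''n'' [] = n" "nmem s1 ''j'' [] = j" "nmem s1 ''q'' [] = q"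
      "nmem s1 ''i'' [] = i" "nmem s1 ''a'' [] = a"
    "rmem s1 ''P'' = rmem s ''P''" "rmem s1 ''supp'' = rmem s ''supp''"
    using s 3 by (simp_all add: frame_def)
  have dot: "runs dot_prog ?s2 (n * 30 + 6) (frame {''c''} {} (rwrite ''u'' [b] (pv b) ?s2))"
    using runs_dot_prog[of ?s2 n j q i a b] s1 3 by (simp add: pv_def)
  show ?case
  proof (rule runs_RAssign_Seq, goal_cases)
    case 2
    show ?case
    proof (rule runs_Seq[where ?T1.0="n * 30 + 6"
        and ?Q1.0="frame {''c''} {} (rwrite ''u'' [b] (pv b) ?s2)"], goal_cases)
      case 1
      then show ?case using dot 3(4) by simp
    next
      case (3 s3)
      then show ?case using s1 \<open>frame _ _ s s1 \<and> _\<close> \<open>nmem s1 ''b'' [] = b\<close>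
        by (intro runs_RAssign) (simp_all add: frame_def less_Suc_eq)
    qed simp
  qed simp
qed (use s in \<open>auto simp: frame_def algebra_simps\<close>)

text \<open>A row of the deflated matrix. For \<open>d = 0\<close> the quotient is 0, the same
  convention as in \<open>deflate\<close>.\<close>

definition row_prog :: com where
  "row_prog = for_loop ''c'' (NConst 0) (nvar ''n'')
     (RAssign ''P'' [NAdd (nvar ''j'') (NConst 1), nvar ''N'', nvar ''b'', nvar ''c'']
       (RSub (RGet ''P'' [nvar ''j'', nvar ''q'', nvar ''b'', nvar ''c''])
         (RDiv (RMul (RGet ''u'' [nvar ''b'']) (RGet ''u'' [nvar ''c''])) (RGet ''d'' []))))"

text \<open>The parent is read on level \<open>j\<close> and the child written on level
  \<open>j + 1\<close>, so no entry is overwritten before it is used.\<close>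

lemma runs_row_prog:
  assumes s: "nmem s ''n'' [] = n" "nmem s ''j'' [] = j" "nmem s ''q'' [] = q"
      "nmem s ''N'' [] = N" "nmem s ''b'' [] = b"
  shows "runs row_prog s (n * 36 + 6) (\<lambda>s'. frame {''c''} {''P''} s s' \<and>
     (\<forall>c<n. rmem s' ''P'' [Suc j, N, b, c] =
        rmem s ''P'' [j, q, b, c] - rmem s ''u'' [b] * rmem s ''u'' [c] / rmem s ''d'' []) \<and>
     (\<forall>j' q' b' c. (j', q', b') \<noteq> (Suc j, N, b) \<longrightarrow> rmem s' ''P'' [j', q', b', c] = rmem s ''P''
         [j', q', b', c]))"
  unfolding row_prog_def
proof (rule runs_for_loop[where A=0 and B=n and T=28 and I="\<lambda>c0 s'. frame {''c''} {''P''} s s' \<and>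
     (\<forall>c<c0. rmem s' ''P'' [Suc j, N, b, c] =
        rmem s ''P'' [j, q, b, c] - rmem s ''u'' [b] * rmem s ''u'' [c] / rmem s ''d'' []) \<and>
     (\<forall>j' q' b' c. (j', q', b') \<noteq> (Suc j, N, b) \<longrightarrow> rmem s' ''P'' [j', q', b', c] = rmem s ''P''
         [j', q', b', c])"], goal_cases)
  case (3 c s1)
  show ?case by (rule runs_RAssign) (use s 3 in \<open>simp_all add: frame_def less_Suc_eq\<close>)
qed (use s in \<open>auto simp: frame_def\<close>)

definition update_prog :: com where
  "update_prog = for_loop ''b'' (NConst 0) (nvar ''n'') row_prog"

lemma runs_update_prog:
  assumes s: "nmem s ''n'' [] = n" "nmem s ''j'' [] = j" "nmem s ''q'' [] = q" "nmem s ''N'' [] = N"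
  shows "runs update_prog s (n * (n * 36 + 20) + 6) (\<lambda>s'. frame {''b'', ''c''} {''P''} s s' \<and>
     (\<forall>b<n. \<forall>c<n. rmem s' ''P'' [Suc j, N, b, c] =
        rmem s ''P'' [j, q, b, c] - rmem s ''u'' [b] * rmem s ''u'' [c] / rmem s ''d'' []) \<and>
     (\<forall>j' q' b' c. (j', q') \<noteq> (Suc j, N) \<longrightarrow> rmem s' ''P'' [j', q', b', c] = rmem s ''P''
         [j', q', b', c]))"
  unfolding update_prog_def
proof (rule runs_for_loop[where A=0 and B=n and T="n * 36 + 6"
    and I="\<lambda>b0 s'. frame {''b'', ''c''} {''P''} s s' \<and>
     (\<forall>b<b0. \<forall>c<n. rmem s' ''P'' [Suc j, N, b, c] =
        rmem s ''P'' [j, q, b, c] - rmem s ''u'' [b] * rmem s ''u'' [c] / rmem s ''d'' []) \<and>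
     (\<forall>j' q' b' c. (j', q') \<noteq> (Suc j, N) \<longrightarrow> rmem s' ''P'' [j', q', b', c] = rmem s ''P''
         [j', q', b', c])"], goal_cases)
  case (3 b s1)
  have s1: "nmem s1 ''n'' [] = n" "nmem s1 ''j'' [] = j" "nmem s1 ''q'' [] = q"
      "nmem s1 ''N'' [] = N"
    using s 3 by (simp_all add: frame_def)
  show ?case
  proof (rule runs_mono[OF runs_row_prog[OF s1 3(4)] order.refl], goal_cases)
    case (1 s2)
    have "rmem s2 ''P'' [j', q', b', c] = rmem s ''P'' [j', q', b', c]" if "(j', q') \<noteq> (Suc j, N)"
        for j' q' b' c
    proof -
      have "(j', q', b') \<noteq> (Suc j, N, b)" using that by auto
      then have "rmem s2 ''P'' [j', q', b', c] = rmem s1 ''P'' [j', q', b', c]" using 1 by blast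
      also have "\<dots> = rmem s ''P'' [j', q', b', c]" using 3 that by blast
      finally show ?thesis .
    qed
    then show ?case using 1 3 by (simp add: frame_def less_Suc_eq)
  qed
qed (use s in \<open>auto simp: frame_def algebra_simps\<close>)

text \<open>Each level contributes a factor -1 to the weight, which supplies the sign of the
  coefficient. The weight is added to \<open>out\<close> at once, so a finished level requires no
  further summation.\<close>

definition child_prog :: com where
  "child_prog = RAssign ''d'' [] (RConst 0) ;; apply_prog ;; update_prog ;;
     RAssign ''w'' [NAdd (nvar ''j'') (NConst 1), nvar ''N'']
       (RSub (RConst 0) (RMul (RMul (RGet ''w'' [nvar ''j'', nvar ''q''])
           (RGet ''prob'' [nvar ''i'', nvar ''a'']))
         (RGet ''d'' []))) ;;
     NAssign ''last'' [NAdd (nvar ''j'') (NConst 1), nvar ''N''] (nvar ''i'') ;;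
     RAssign ''out'' [NAdd (nvar ''j'') (NConst 1)]
         (RAdd (RGet ''out'' [NAdd (nvar ''j'') (NConst 1)])
       (RGet ''w'' [NAdd (nvar ''j'') (NConst 1), nvar ''N''])) ;;
     NAssign ''N'' [] (NAdd (nvar ''N'') (NConst 1))"

lemma runs_child_prog:
  assumes s: "nmem s ''n'' [] = n" "nmem s ''j'' [] = j" "nmem s ''q'' [] = q"
      "nmem s ''i'' [] = i" "nmem s ''a'' [] = a" "nmem s ''N'' [] = N"
    and pv_def: "pv = (\<lambda>b. \<Sum>c<n. rmem s ''P'' [j, q, b, c] * rmem s ''supp'' [i, a, c])"
    and d_def: "d = (\<Sum>b<n. pv b * rmem s ''supp'' [i, a, b])"
    and w'_def: "w' = - (rmem s ''w'' [j, q] * rmem s ''prob'' [i, a] * d)"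
  shows "runs child_prog s (n * (n * 66 + 70) + 70) (\<lambda>s'.
     frame {''b'', ''c'', ''last'', ''N''} {''d'', ''u'', ''P'', ''w'', ''out''} s s' \<and>
     nmem s' ''last'' = (nmem s ''last'')([Suc j, N] := i) \<and>
     nmem s' ''N'' = (nmem s ''N'')([] := Suc N) \<and>
     rmem s' ''w'' = (rmem s ''w'')([Suc j, N] := w') \<and>
     rmem s' ''out'' = (rmem s ''out'')([Suc j] := rmem s ''out'' [Suc j] + w') \<and>
     (\<forall>b<n. \<forall>c<n. rmem s' ''P'' [Suc j, N, b, c] = rmem s ''P'' [j, q, b, c] - pv b * pv c / d) \<and>
     (\<forall>j' q' b' c. (j', q') \<noteq> (Suc j, N) \<longrightarrow> rmem s' ''P'' [j', q', b', c] = rmem s ''P''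
         [j', q', b', c]))"
  unfolding child_prog_def
proof (rule runs_RAssign_Seq, goal_cases)
  case 2
  let ?s1 = "rwrite ''d'' [] 0 s"
  have 1: "runs apply_prog ?s1 (n * (n * 30 + 50) + 10)
      (\<lambda>s'. frame {''b'', ''c''} {''u'', ''d''} ?s1 s' \<and>
     (\<forall>b<n. rmem s' ''u'' [b] = pv b) \<and> rmem s' ''d'' [] = d)"
    using runs_apply_prog[of ?s1 n j q i a] s by (simp add: pv_def d_def)
  show ?case
  proof (rule runs_Seq[where ?T1.0="n * (n * 30 + 50) + 10"
      and ?Q1.0="\<lambda>s'. frame {''b'', ''c''} {''u'', ''d''} ?s1 s' \<and>
     (\<forall>b<n. rmem s' ''u'' [b] = pv b) \<and> rmem s' ''d'' [] = d"], goal_cases)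
    case 1
    then show ?case using \<open>runs apply_prog _ _ _\<close> by simp
  next
    case 2
    then show ?case by (simp add: algebra_simps)
  next
    case (3 s2)
    have s2: "nmem s2 ''n'' [] = n" "nmem s2 ''j'' [] = j" "nmem s2 ''q'' [] = q"
        "nmem s2 ''N'' [] = N"
      using s 3 by (simp_all add: frame_def)
    have P: "rmem s2 ''P'' = rmem s ''P''" using 3 by (simp add: frame_def)
    show ?case
    proof (rule runs_Seq[OF runs_update_prog[OF s2]], goal_cases)
      case 1
      then show ?case by (simp add: algebra_simps)
    next
      case (2 s3)
      \<comment> \<open>The four assignments that remain cost 40 steps.\<close>
      have T: "50 \<le> n * (n * 66 + 70) + 70 - (1 + sum_list (map ncost []) + rcost (RConst 0)) -
           (n * (n * 30 + 50) + 10) - (n * (n * 36 + 20) + 6)" (is "_ \<le> ?T")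
        by (simp add: algebra_simps)
      show ?case
        by (rule runs_mono[OF _ T], rule runs_RAssign_Seq, simp, rule runs_NAssign_Seq, simp,
          rule runs_RAssign_Seq, simp, rule runs_NAssign, simp)
          (use s s2 P 2 3 in \<open>simp_all add: frame_def w'_def\<close>)
    qed
  qed
qed simp

section \<open>Enumeration of the levels\<close>

definition a_prog :: com where
  "a_prog = for_loop ''a'' (NConst 0) (NGet ''size'' [nvar ''i'']) child_prog"

text \<open>Starting just above the last index makes the sequences strictly increasing; the root has
  last index 0, so its children use all indices from 1 to \<open>m\<close>.\<close>

definition i_prog :: com where
  "i_prog = for_loop ''i'' (NAdd (NGet ''last'' [nvar ''j'', nvar ''q'']) (NConst 1))
      (NAdd (nvar ''m'') (NConst 1)) a_prog"

definition q_prog :: com where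
  "q_prog = for_loop ''q'' (NConst 0) (NGet ''cnt'' [nvar ''j'']) i_prog"

definition level_prog :: com where
  "level_prog = NAssign ''N'' [] (NConst 0) ;; q_prog ;;
     NAssign ''cnt'' [NAdd (nvar ''j'') (NConst 1)] (nvar ''N'')"

definition main_prog :: com where "main_prog = for_loop ''j'' (NConst 0) (nvar ''k'') level_prog"

section \<open>Invariants of a level and their preservation\<close>

context
  fixes n m k M :: nat and sz :: "nat \<Rightarrow> nat" and V :: "nat \<Rightarrow> nat \<Rightarrow> real vec" and pr ::
      "nat \<Rightarrow> nat \<Rightarrow> real"
begin

text \<open>The data as the enumeration sees them, after the fixed vectors have become supports of
  size 1; hence no reference to \<open>l\<close>.\<close>

definition holds_input :: "state \<Rightarrow> bool" where
  "holds_input s \<longleftrightarrow> nmem s ''n'' [] = n \<and> nmem s ''m'' [] = m \<and> nmem s ''k'' [] = k \<and>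
     (\<forall>i\<in>{1..m}. nmem s ''size'' [i] = sz i \<and>
        (\<forall>a<sz i. rmem s ''prob'' [i, a] = pr i a \<and> (\<forall>c<n. rmem s ''supp'' [i, a, c] = V i a $ c)))"

definition node_mat :: "state \<Rightarrow> nat \<Rightarrow> nat \<Rightarrow> real mat" where
  "node_mat s j q = Matrix.mat n n (\<lambda>(b, c). rmem s ''P'' [j, q, b, c])"

definition node_sum :: "state \<Rightarrow> nat \<Rightarrow> nat \<Rightarrow> (real mat \<Rightarrow> nat \<Rightarrow> real) \<Rightarrow> real" where
  "node_sum s j N F = (\<Sum>q<N. rmem s ''w'' [j, q] * F (node_mat s j q) (nmem s ''last'' [j, q]))"

definition child_term :: "(nat \<Rightarrow> real mat) \<Rightarrow> (nat \<Rightarrow> real) \<Rightarrow> nat \<Rightarrow> nat \<Rightarrow> nat \<Rightarrow>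
    (real mat \<Rightarrow> nat \<Rightarrow> real) \<Rightarrow> real" where
  "child_term PM W q i a F =
     - (W q * pr i a * (V i a \<bullet> (PM q *\<^sub>v V i a))) * F (deflate (PM q) (V i a)) i"

text \<open>
  Holds while the children of the nodes of level \<open>j\<close> are generated.  The level under construction is
  described only through the functional \<open>G\<close>, the sum of an arbitrary function \<open>F\<close> over its nodes
  weighted by their weights; this avoids any bookkeeping of which node is stored where.
\<close>
definition level_inv where
  "level_inv j PM W LS cn ot C G s \<longleftrightarrow> holds_input s \<and> nmem s ''j'' [] = j \<and> nmem s ''cnt'' = cn \<and>
     (\<forall>q. node_mat s j q = PM q \<and> rmem s ''w'' [j, q] = W q \<and> nmem s ''last'' [j, q] = LS q) \<and>
     nmem s ''N'' [] \<le> C \<and> (\<forall>F. node_sum s (Suc j) (nmem s ''N'' []) F = G F) \<and>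
     rmem s ''out'' [Suc j] = G (\<lambda>_ _. 1) \<and> (\<forall>x. x \<noteq> [Suc j] \<longrightarrow> rmem s ''out'' x = ot x)"

text \<open>Times for the loops over \<open>a\<close> and over \<open>i\<close>; 79 is the constant
  part 70 of a child plus 9 for test and increment.\<close>

definition a_time :: nat where "a_time = M * (n * (n * 66 + 70) + 79) + 7"
definition i_time :: nat where "i_time = m * (a_time + 10) + 12"

text \<open>Because the equation holds for every \<open>F\<close>, it can be applied to
  \<open>level_step F\<close> and so passes to the next level; for the constant 1 it yields the path
  sum. The zeros in \<open>out\<close> above \<open>j\<close> let the next level accumulate from
  0.\<close>

definition main_inv :: "nat \<Rightarrow> state \<Rightarrow> bool" where
  "main_inv j s \<longleftrightarrow> holds_input s \<and>
     (\<forall>F. node_sum s j (nmem s ''cnt'' [j]) F = (level_step m sz V pr ^^ j) F (1\<^sub>m n) 0) \<and>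
     nmem s ''cnt'' [j] \<le> (m * M) ^ j \<and>
     (\<forall>j'\<in>{1..j}. rmem s ''out'' [j'] = path_sum m sz V pr j' (1\<^sub>m n) 0) \<and>
         (\<forall>j'>j. rmem s ''out'' [j'] = 0)"

context
  assumes V: "\<And>i a. i \<in> {1..m} \<Longrightarrow> a < sz i \<Longrightarrow> V i a \<in> carrier_vec n"
    and sz: "\<And>i. i \<in> {1..m} \<Longrightarrow> sz i \<le> M"
begin

lemma level_inv_mono: "level_inv j PM W LS cn ot C G s \<Longrightarrow> C \<le> C' \<Longrightarrow> level_inv j PM W LS cn ot C' G s"
  by (auto simp: level_inv_def)

lemma level_inv_nwrite:
  "x \<in> {''a'', ''i'', ''q''} \<Longrightarrow> level_inv j PM W LS cn ot C G (nwrite x [] v s) =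
      level_inv j PM W LS cn ot C G s"
  by (auto simp: level_inv_def holds_input_def node_mat_def node_sum_def)

text \<open>The sums formed by the loops are matched with \<open>PM q *\<^sub>v V i a\<close>, its
  quadratic form and the deflation. The new node is the last summand of the functional, and all
  other nodes are unchanged.\<close>

lemma runs_child_prog_inv:
  assumes inv: "level_inv j PM W LS cn ot C G s"
    and q: "nmem s ''q'' [] = q" and i: "nmem s ''i'' [] = i" "i \<in> {1..m}" and a:
        "nmem s ''a'' [] = a" "a < sz i"
  shows "runs child_prog s (n * (n * 66 + 70) + 70) (\<lambda>s'.
     level_inv j PM W LS cn ot (Suc C) (\<lambda>F. G F + child_term PM W q i a F) s' \<and>
     nmem s' ''q'' [] = q \<and> nmem s' ''i'' [] = i \<and> nmem s' ''a'' [] = a)"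
proof -
  define N where "N = nmem s ''N'' []"
  have s: "nmem s ''n'' [] = n" "nmem s ''j'' [] = j" using inv
      by (simp_all add: level_inv_def holds_input_def)
  let ?v = "V i a"
  define pv where "pv = (\<lambda>b. \<Sum>c<n. rmem s ''P'' [j, q, b, c] * rmem s ''supp'' [i, a, c])"
  define d where "d = (\<Sum>b<n. pv b * rmem s ''supp'' [i, a, b])"
  have PM: "PM q = node_mat s j q" using inv by (simp add: level_inv_def)
  have v: "?v \<in> carrier_vec n" using V i a by simp
  have supp: "rmem s ''supp'' [i, a, c] = ?v $ c" if "c < n" for c
    using inv i a that by (simp add: level_inv_def holds_input_def)
  have prob: "rmem s ''prob'' [i, a] = pr i a"
    using inv i a by (simp add: level_inv_def holds_input_def)
  have W: "rmem s ''w'' [j, q] = W q" using inv by (simp add: level_inv_def)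
  have pv: "(PM q *\<^sub>v ?v) $ b = pv b" if "b < n" for b
    using that v by (simp add: PM node_mat_def pv_def scalar_prod_def supp lessThan_atLeast0)
  have dimPM: "dim_vec (PM q *\<^sub>v ?v) = n" by (simp add: PM node_mat_def)
  have d: "?v \<bullet> (PM q *\<^sub>v ?v) = d"
    unfolding scalar_prod_def[of ?v] dimPM d_def lessThan_atLeast0
    by (rule sum.cong) (simp_all add: pv supp mult.commute del: index_mult_mat_vec)
  have defl: "deflate (PM q) ?v = Matrix.mat n n
      (\<lambda>(b, c). rmem s ''P'' [j, q, b, c] - pv b * pv c / d)"
  proof (rule eq_matI, goal_cases)
    case (1 b c)
    then have bc: "b < n" "c < n" by simp_all
    then have "PM q $$ (b, c) = rmem s ''P'' [j, q, b, c]" "dim_row (PM q) = n" "dim_col (PM q) = n"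
      by (simp_all add: PM node_mat_def)
    then show ?case using bc by (simp add: deflate_def d outer_def dimPM pv del: index_mult_mat_vec)
  qed (simp_all add: deflate_def outer_def PM node_mat_def)
  note run = runs_child_prog[OF s q i(1) a(1) N_def[symmetric] pv_def d_def refl, unfolded prob W]
  show ?thesis
  proof (rule runs_mono[OF run order.refl], goal_cases)
    case (1 s')
    \<comment> \<open>Only node \<open>N\<close> of the new level is written, so the parents and the
      earlier children keep their matrices.\<close>
    have other: "node_mat s' j' q' = node_mat s j' q'" if "(j', q') \<noteq> (Suc j, N)" for j' q'
      unfolding node_mat_def by (rule cong_mat) (use 1 that in auto)
    have new: "node_mat s' (Suc j) N = deflate (PM q) ?v"
      unfolding node_mat_def defl by (rule cong_mat) (use 1 in auto)
    have "holds_input s'" using 1 inv by (simp add: level_inv_def holds_input_def frame_def)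
    moreover have "node_sum s' (Suc j) (Suc N) F = G F + child_term PM W q i a F" for F
    proof -
      have "node_sum s' (Suc j) N F = node_sum s (Suc j) N F"
        unfolding node_sum_def by (rule sum.cong) (use 1 other in auto)
      also have "\<dots> = G F" using inv by (simp add: level_inv_def N_def)
      finally show ?thesis using 1 by (simp add: node_sum_def new child_term_def d)
    qed
    moreover have "rmem s' ''out'' [Suc j] = G (\<lambda>_ _. 1) + child_term PM W q i a (\<lambda>_ _. 1)"
      using 1 inv by (simp add: level_inv_def child_term_def d)
    ultimately show ?case
      using 1 inv q i a other by (simp add: level_inv_def frame_def N_def[symmetric])
  qed
qed

lemma runs_a_prog:
  assumes inv: "level_inv j PM W LS cn ot C G s"
    and q: "nmem s ''q'' [] = q" and i: "nmem s ''i'' [] = i" "i \<in> {1..m}"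
  shows "runs a_prog s a_time (\<lambda>s'.
     level_inv j PM W LS cn ot (C + M) (\<lambda>F. G F + (\<Sum>a<sz i. child_term PM W q i a F)) s' \<and>
     nmem s' ''q'' [] = q \<and> nmem s' ''i'' [] = i)"
  unfolding a_prog_def
proof (rule runs_for_loop[where A=0 and B="sz i" and T="n * (n * 66 + 70) + 70" and
    I="\<lambda>a s'. level_inv j PM W LS cn ot (C + a) (\<lambda>F. G F + (\<Sum>a<a. child_term PM W q i a F)) s' \<and>
     nmem s' ''q'' [] = q \<and> nmem s' ''i'' [] = i"], goal_cases)
  case 2
  then show ?case using assms by (simp add: level_inv_nwrite)
next
  case (3 a s1)
  then show ?case
    by (intro runs_mono[OF runs_child_prog_inv[OF _ _ _ i(2)] order.refl, of j PM W LS cn ot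
        "C + a" "\<lambda>F. G F + (\<Sum>a<a. child_term PM W q i a F)" _ q a])
       (auto simp: level_inv_nwrite add.assoc)
next
  case (4 a s1)
  then show ?case using i by (simp add: level_inv_def holds_input_def)
next
  case (5 s1)
  then show ?case using sz[OF i(2)] by (auto intro: level_inv_mono)
next
  case 6
  have "sz i * (n * (n * 66 + 70) + 79) \<le> M * (n * (n * 66 + 70) + 79)"
    using sz[OF i(2)] by (rule mult_le_mono1)
  then show ?case by (simp add: a_time_def algebra_simps)
qed simp

text \<open>Summing \<open>child_term\<close> over the indices above \<open>LS q\<close> and their
  support vectors gives \<open>W q\<close> times the defining sum of
  \<open>level_step\<close>.\<close>

lemma runs_i_prog:
  assumes inv: "level_inv j PM W LS cn ot C G s" and q: "nmem s ''q'' [] = q"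
  shows "runs i_prog s i_time (\<lambda>s'.
     level_inv j PM W LS cn ot (C + m * M) (\<lambda>F. G F + W q * level_step m sz V pr F (PM q) (LS q))
         s' \<and>
     nmem s' ''q'' [] = q)"
  unfolding i_prog_def
proof (rule runs_for_loop[where A="LS q + 1" and B="m + 1" and T=a_time and
    I="\<lambda>i s'. level_inv j PM W LS cn ot (C + (i - (LS q + 1)) * M)
       (\<lambda>F. G F + (\<Sum>i'=LS q + 1..<i. \<Sum>a<sz i'. child_term PM W q i' a F)) s' \<and> nmem s' ''q'' [] =
           q"], goal_cases)
  case 1
  then show ?case using assms by (simp add: level_inv_def)
next
  case 2
  then show ?case using assms by (simp add: level_inv_nwrite)
next
  case (3 i s1)
  then have i: "i \<in> {1..m}" by simp
  have C: "C + (i - (LS q + 1)) * M + M = C + (Suc i - (LS q + 1)) * M"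
  proof -
    have "Suc i - (LS q + 1) = Suc (i - (LS q + 1))" using 3(1) by simp
    then show ?thesis by simp
  qed
  have G: "(\<lambda>F. G F + (\<Sum>i'=LS q + 1..<i. \<Sum>a<sz i'. child_term PM W q i' a F) +
      (\<Sum>a<sz i. child_term PM W q i a F))
     = (\<lambda>F. G F + (\<Sum>i'=LS q + 1..<Suc i. \<Sum>a<sz i'. child_term PM W q i' a F))"
    using 3(1) by (simp add: add.assoc)
  show ?case
    by (rule runs_mono[OF runs_a_prog[OF conjunct1[OF 3(3)] conjunct2[OF 3(3)] 3(4) i] order.refl,
        unfolded C G])
       (auto simp: level_inv_nwrite)
next
  case (4 i s1)
  then show ?case by (simp add: level_inv_def holds_input_def)
next
  case (5 s1)
  \<comment> \<open>If the last index is already at least \<open>m\<close>, both intervals are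
    empty.\<close>
  have "{LS q + 1..<max (LS q + 1) (m + 1)} = {LS q + 1..m}" by auto
  then have "(\<lambda>F. G F + (\<Sum>i'=LS q + 1..<max (LS q + 1) (m + 1). \<Sum>a<sz i'. child_term PM W q i' a F))
    = (\<lambda>F. G F + W q * level_step m sz V pr F (PM q) (LS q))"
    by (auto simp: level_step_def child_term_def sum_distrib_left algebra_simps)
  moreover have "C + (max (LS q + 1) (m + 1) - (LS q + 1)) * M \<le> C + m * M" by (simp add: max_def)
  ultimately show ?case using 5 by (auto intro: level_inv_mono)
next
  case 6
  have "(m + 1 - (LS q + 1)) * (a_time + 10) \<le> m * (a_time + 10)" by (intro mult_le_mono1) simp
  then show ?case by (simp add: i_time_def algebra_simps)
qed

lemma runs_q_prog:
  assumes inv: "level_inv j PM W LS cn ot 0 (\<lambda>_. 0) s"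
  shows "runs q_prog s (cn [j] * (i_time + 9) + 7) (\<lambda>s'.
     level_inv j PM W LS cn ot (cn [j] * (m * M))
         (\<lambda>F. \<Sum>q<cn [j]. W q * level_step m sz V pr F (PM q) (LS q)) s')"
  unfolding q_prog_def
proof (rule runs_for_loop[where A=0 and B="cn [j]" and T=i_time and
    I="\<lambda>q s'. level_inv j PM W LS cn ot (q * (m * M))
        (\<lambda>F. \<Sum>q<q. W q * level_step m sz V pr F (PM q) (LS q)) s'"], goal_cases)
  case 2
  then show ?case using assms by (simp add: level_inv_nwrite)
next
  case (3 q s1)
  show ?case
    by (rule runs_mono[OF runs_i_prog[OF 3(3,4)] order.refl])
        (auto simp: level_inv_nwrite add.commute)
next
  case (4 q s1)
  then show ?case by (simp add: level_inv_def)
qed simp_all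

lemma main_inv_nwrite: "main_inv j (nwrite ''j'' [] v s) = main_inv j s"
proof -
  have "node_sum (nwrite ''j'' [] v s) = node_sum s"
      by (simp add: node_sum_def node_mat_def fun_eq_iff)
  moreover have "holds_input (nwrite ''j'' [] v s) = holds_input s" by (simp add: holds_input_def)
  ultimately show ?thesis by (simp add: main_inv_def)
qed

lemma path_sum_funpow: "path_sum m sz V pr j = (level_step m sz V pr ^^ j) (\<lambda>_ _. 1)"
  by (induction j) simp_all

lemma runs_level_prog:
  assumes inv: "main_inv j s" and j: "nmem s ''j'' [] = j"
  shows "runs level_prog s ((m * M) ^ j * (i_time + 9) + 14)
      (\<lambda>s'. main_inv (Suc j) s' \<and> nmem s' ''j'' [] = j)"
  unfolding level_prog_def
proof (rule runs_NAssign_Seq, goal_cases)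
  case 2
  let ?s1 = "nwrite ''N'' [] 0 s"
  let ?cn = "nmem s ''cnt''"
  let ?PM = "\<lambda>q. node_mat s j q" and ?W = "\<lambda>q. rmem s ''w'' [j, q]" and ?LS =
      "\<lambda>q. nmem s ''last'' [j, q]"
  have "level_inv j ?PM ?W ?LS ?cn (rmem s ''out'') 0 (\<lambda>_. 0) ?s1"
    using inv j by (simp add: level_inv_def main_inv_def holds_input_def node_mat_def node_sum_def)
  note run = runs_q_prog[OF this]
  have cnt: "?cn [j] \<le> (m * M) ^ j" using inv by (simp add: main_inv_def)
  then have T: "?cn [j] * (i_time + 9) + 7 \<le> (m * M) ^ j * (i_time + 9) + 7" by simp
  show ?case
  proof (rule runs_Seq[where ?T1.0="(m * M) ^ j * (i_time + 9) + 7"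
      and ?Q1.0="level_inv j ?PM ?W ?LS ?cn (rmem s ''out'')
      (?cn [j] * (m * M)) (\<lambda>F. \<Sum>q<?cn [j]. ?W q * level_step m sz V pr F (?PM q) (?LS q))"],
          goal_cases)
    case 1
    show ?case using runs_mono[OF run T] by simp
  next
    case (3 s2)
    \<comment> \<open>Each of the at most \<open>(m * M) ^ j\<close> nodes has at most
      \<open>m * M\<close> children.\<close>
    have "(m * M) ^ Suc j = (m * M) ^ j * (m * M)" by simp
    then have le: "?cn [j] * (m * M) \<le> (m * M) ^ Suc j" using cnt by (metis mult_le_mono1)
    \<comment> \<open>The invariant is used with \<open>level_step F\<close> in place of
      \<open>F\<close>; the new application sits innermost, hence
      \<open>funpow_Suc_right\<close>.\<close>
    have eq: "(\<Sum>q<?cn [j]. ?W q * level_step m sz V pr F (?PM q) (?LS q)) =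
        (level_step m sz V pr ^^ Suc j) F (1\<^sub>m n) 0" for F
    proof -
      have "(\<Sum>q<?cn [j]. ?W q * level_step m sz V pr F (?PM q) (?LS q)) =
          node_sum s j (?cn [j]) (level_step m sz V pr F)"
        by (simp add: node_sum_def)
      also have "\<dots> = (level_step m sz V pr ^^ j) (level_step m sz V pr F) (1\<^sub>m n) 0"
        using inv by (simp add: main_inv_def)
      also have "\<dots> = (level_step m sz V pr ^^ Suc j) F (1\<^sub>m n) 0"
          by (simp only: funpow_Suc_right o_apply)
      finally show ?thesis .
    qed
    have l2: "level_inv j ?PM ?W ?LS ?cn (rmem s ''out'') ((m * M) ^ Suc j)
        (\<lambda>F. (level_step m sz V pr ^^ Suc j) F (1\<^sub>m n) 0) s2"
      using level_inv_mono[OF 3 le] by (simp only: eq)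
    have out: "rmem s2 ''out'' [j'] = path_sum m sz V pr j' (1\<^sub>m n) 0" if "j' \<in> {1..Suc j}" for j'
    proof (cases "j' = Suc j")
      case True
      then show ?thesis using l2 by (simp only: level_inv_def path_sum_funpow)
    next
      case False
      then show ?thesis using l2 inv that by (simp add: level_inv_def main_inv_def)
    qed
    have out0: "rmem s2 ''out'' [j'] = 0" if "j' > Suc j" for j'
      using l2 inv that by (simp add: level_inv_def main_inv_def)
    show ?case
    proof (rule runs_NAssign, goal_cases)
      case 2
      have sum: "node_sum (nwrite ''cnt'' x v s2) = node_sum s2" for x v
        by (simp add: node_sum_def node_mat_def fun_eq_iff)
      have inp: "holds_input (nwrite ''cnt'' x v s2) = holds_input s2" for x v
        by (simp add: holds_input_def)
      show ?case using l2 out out0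
        by (simp add: main_inv_def sum inp level_inv_def del: funpow.simps)
    qed simp
  qed simp
qed simp

text \<open>Levels 0 to \<open>k - 1\<close> are expanded, and since \<open>m * M\<close> is
  positive, each has at most \<open>(m * M) ^ (k - 1)\<close> nodes. The last factor
  \<open>m * M\<close> is contained in \<open>i_time\<close>.\<close>

lemma runs_main_prog:
  assumes inv: "main_inv 0 s" and mM: "0 < m * M"
  shows "runs main_prog s (k * ((m * M) ^ (k - 1) * (i_time + 9) + 22) + 6) (\<lambda>s'. main_inv k s')"
  unfolding main_prog_def
proof (rule runs_for_loop[where A=0 and B=k and T="(m * M) ^ (k - 1) * (i_time + 9) + 14"
    and I=main_inv], goal_cases)
  case 2
  then show ?case using inv by (simp add: main_inv_nwrite)
next
  case (3 j s1)
  have "(m * M) ^ j \<le> (m * M) ^ (k - 1)" using 3 mM by (intro power_increasing) auto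
  then have "(m * M) ^ j * (i_time + 9) + 14 \<le> (m * M) ^ (k - 1) * (i_time + 9) + 14"
    by (intro add_right_mono mult_right_mono) simp_all
  then show ?case
    by (rule runs_mono[OF runs_level_prog[OF 3(3,4)]]) (simp add: main_inv_nwrite)
next
  case (4 j s1)
  then have "holds_input s1" unfolding main_inv_def by blast
  then show ?case by (simp add: holds_input_def)
qed simp_all

end

end

section \<open>Initialisation and the main result\<close>

definition copy_prog :: com where
  "copy_prog = for_loop ''c'' (NConst 0) (nvar ''n'')
     (RAssign ''supp'' [nvar ''i'', NConst 0, nvar ''c'']
         (RGet ''fixed'' [nvar ''i'', nvar ''c'']))"

lemma runs_copy_prog:
  assumes s: "nmem s ''n'' [] = n" "nmem s ''i'' [] = i"
  shows "runs copy_prog s (n * 15 + 6) (\<lambda>s'. frame {''c''} {''supp''} s s' \<and>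
     (\<forall>c<n. rmem s' ''supp'' [i, 0, c] = rmem s ''fixed'' [i, c]) \<and>
     (\<forall>i' a c. i' \<noteq> i \<longrightarrow> rmem s' ''supp'' [i', a, c] = rmem s ''supp'' [i', a, c]))"
  unfolding copy_prog_def
proof (rule runs_for_loop[where A=0 and B=n and T=7 and I="\<lambda>c0 s'. frame {''c''} {''supp''} s s' \<and>
     (\<forall>c<c0. rmem s' ''supp'' [i, 0, c] = rmem s ''fixed'' [i, c]) \<and>
     (\<forall>i' a c. i' \<noteq> i \<longrightarrow> rmem s' ''supp'' [i', a, c] = rmem s ''supp'' [i', a, c])"], goal_cases)
  case (3 c s1)
  show ?case by (rule runs_RAssign) (use s 3 in \<open>simp_all add: frame_def less_Suc_eq\<close>)
qed (use s in \<open>simp_all add: frame_def\<close>)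

text \<open>Turns each fixed vector into a distribution with one point, which realises
  \<open>eff_size\<close>, \<open>eff_vec\<close> and \<open>eff_prob\<close>. Old entries at
  positions above 0 stay in memory but lie beyond the new size.\<close>

definition fixed_prog :: com where
  "fixed_prog = for_loop ''i'' (NConst 1) (NAdd (nvar ''l'') (NConst 1))
     (NAssign ''size'' [nvar ''i''] (NConst 1) ;;
      RAssign ''prob'' [nvar ''i'', NConst 0] (RConst 1) ;; copy_prog)"

lemma runs_fixed_prog:
  assumes s: "nmem s ''n'' [] = n" "nmem s ''l'' [] = l"
  shows "runs fixed_prog s (l * (n * 15 + 23) + 8)
      (\<lambda>s'. frame {''i'', ''c'', ''size''} {''prob'', ''supp''} s s' \<and>
     (\<forall>i\<in>{1..l}. nmem s' ''size'' [i] = 1 \<and> rmem s' ''prob'' [i, 0] = 1 \<and>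
        (\<forall>c<n. rmem s' ''supp'' [i, 0, c] = rmem s ''fixed'' [i, c])) \<and>
     (\<forall>i>l. nmem s' ''size'' [i] = nmem s ''size'' [i] \<and>
         (\<forall>a. rmem s' ''prob'' [i, a] = rmem s ''prob'' [i, a]) \<and>
        (\<forall>a c. rmem s' ''supp'' [i, a, c] = rmem s ''supp'' [i, a, c])))"
  unfolding fixed_prog_def
proof (rule runs_for_loop[where A=1 and B="l + 1" and T="n * 15 + 13" and
    I="\<lambda>i0 s'. frame {''i'', ''c'', ''size''} {''prob'', ''supp''} s s' \<and>
     (\<forall>i. 1 \<le> i \<longrightarrow> i < i0 \<longrightarrow> nmem s' ''size'' [i] = 1 \<and> rmem s' ''prob'' [i, 0] = 1 \<and>
        (\<forall>c<n. rmem s' ''supp'' [i, 0, c] = rmem s ''fixed'' [i, c])) \<and>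
     (\<forall>i\<ge>i0. nmem s' ''size'' [i] = nmem s ''size'' [i] \<and>
         (\<forall>a. rmem s' ''prob'' [i, a] = rmem s ''prob'' [i, a]) \<and>
        (\<forall>a c. rmem s' ''supp'' [i, a, c] = rmem s ''supp'' [i, a, c]))"], goal_cases)
  case (3 i s1)
  let ?s2 = "rwrite ''prob'' [i, 0] 1 (nwrite ''size'' [i] 1 s1)"
  have s2: "nmem ?s2 ''n'' [] = n" "nmem ?s2 ''i'' [] = i"
    using s 3 by (simp_all add: frame_def)
  show ?case
  proof (rule runs_NAssign_Seq, simp, rule runs_RAssign_Seq, simp, goal_cases)
    case 1
    have eq: "rwrite ''prob'' (map (\<lambda>e. nval e
        (nwrite ''size'' (map (\<lambda>e. nval e s1) [nvar ''i'']) (nval (NConst 1) s1) s1))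
        [nvar ''i'', NConst 0])
       (rval (RConst 1) (nwrite ''size'' (map (\<lambda>e. nval e s1) [nvar ''i'']) (nval (NConst 1) s1)
           s1))
       (nwrite ''size'' (map (\<lambda>e. nval e s1) [nvar ''i'']) (nval (NConst 1) s1) s1) = ?s2"
      using 3 by simp
    show ?case unfolding eq
    proof (rule runs_mono[OF runs_copy_prog[OF s2]], goal_cases)
      case (2 s3)
      have old: "i' < i \<or> i' = i" if "i' < Suc i" for i' using that by auto
      have a: "frame {''i'', ''c'', ''size''} {''prob'', ''supp''} s (nwrite ''i'' [] (Suc i) s3)"
          "nmem s3 ''i'' [] = i"
        using 2 3 by (simp_all add: frame_def)
      have sz: "nmem s3 ''size'' = (nmem s1 ''size'')([i] := 1)"
          "rmem s3 ''prob'' = (rmem s1 ''prob'')([i, 0] := 1)"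
        using 2 by (simp_all add: frame_def)
      have fx: "rmem s1 ''fixed'' = rmem s ''fixed''" using 3 by (simp add: frame_def)
      have b: "nmem s3 ''size'' [i'] = 1 \<and> rmem s3 ''prob'' [i', 0] = 1 \<and>
        (\<forall>c<n. rmem s3 ''supp'' [i', 0, c] = rmem s ''fixed'' [i', c])" if "1 \<le> i'" "i' < Suc
            i" for i'
        using old[OF that(2)] that 2 3 sz fx by auto
      have c: "nmem s3 ''size'' [i'] = nmem s ''size'' [i'] \<and>
          (\<forall>a. rmem s3 ''prob'' [i', a] = rmem s ''prob'' [i', a]) \<and>
        (\<forall>a c. rmem s3 ''supp'' [i', a, c] = rmem s ''supp'' [i', a, c])" if "i' \<ge> Suc i" for i'
        using that 2 3 sz by simp
      show ?case using a b c by simp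
    qed simp
  qed
next
  case (4 i s1)
  then show ?case using s by (simp add: frame_def)
next
  case (5 s1)
  have "max 1 (l + 1) = Suc l" by simp
  with 5 show ?case by auto
next
  case 2
  then show ?case by (simp add: frame_def)
next
  case 6
  then show ?case by simp
qed simp

text \<open>The root stands for the empty sequence. Its last index 0 and the zeros off the diagonal
  are already there, because cells without input data start at 0.\<close>

definition root_prog :: com where
  "root_prog = NAssign ''cnt'' [NConst 0] (NConst 1) ;;
     RAssign ''w'' [NConst 0, NConst 0] (RConst 1) ;;
     for_loop ''b'' (NConst 0) (nvar ''n'')
       (RAssign ''P'' [NConst 0, NConst 0, nvar ''b'', nvar ''b''] (RConst 1))"

lemma runs_root_prog:
  assumes s: "nmem s ''n'' [] = n"
  shows "runs root_prog s (n * 14 + 13) (\<lambda>s'. frame {''cnt'', ''b''} {''w'', ''P''} s s' \<and>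
     nmem s' ''cnt'' [0] = 1 \<and> rmem s' ''w'' [0, 0] = 1 \<and>
     (\<forall>b c. rmem s' ''P'' [0, 0, b, c] = (if b = c \<and> b < n then 1 else rmem s ''P'' [0, 0, b, c])))"
  unfolding root_prog_def
proof (rule runs_NAssign_Seq, simp, rule runs_RAssign_Seq, simp, rule
    runs_for_loop[where A=0 and B=n and T=6 and
    I="\<lambda>b0 s'. frame {''cnt'', ''b''} {''w'', ''P''} s s' \<and>
     nmem s' ''cnt'' [0] = 1 \<and> rmem s' ''w'' [0, 0] = 1 \<and>
     (\<forall>b c. rmem s' ''P'' [0, 0, b, c] = (if b = c \<and> b < b0 then 1 else rmem s ''P''
         [0, 0, b, c]))"], goal_cases)
  case (3 b s1)
  show ?case by (rule runs_RAssign) (use s 3 in \<open>auto simp: frame_def\<close>)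
next
  case 2
  then show ?case by (simp add: frame_def)
next
  case (4 b s1)
  then show ?case using s by (simp add: frame_def)
next
  case (5 s1)
  then show ?case by simp
next
  case 6
  then show ?case by simp
qed simp

section \<open>The total running time\<close>

lemma total_time_bound:
  fixes n m k l M :: nat
  assumes "l \<le> m" "0 < M" "1 \<le> k" "k \<le> n" "0 < m"
  shows "l * (n * 15 + 23) + 8 + (n * 14 + 13) +
      (k * ((m * M) ^ (k - 1) * (i_time n m M + 9) + 22) + 6)
     \<le> (m * M) ^ k * poly [:57, 168, 70, 66:] n"
proof -
  define X where "X = m * M"
  define R where "R = n * (n * 66 + 70) + 117"
  have X: "1 \<le> X" "m \<le> X" using assms by (auto simp: X_def)
  have Xk: "X ^ (k - 1) * X = X ^ k" using assms(3)
      by (metis power_minus_mult less_eq_Suc_le One_nat_def)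
  have "X \<le> X ^ k" using X assms(3) by (simp add: self_le_power)
  then have E: "1 \<le> X ^ k" "l \<le> X ^ k" using X assms(1) by linarith+
  have "i_time n m M + 9 = X * (n * (n * 66 + 70) + 79) + m * 17 + 21"
    by (simp add: i_time_def a_time_def X_def algebra_simps)
  \<comment> \<open>Uses \<open>m \<le> X\<close> and \<open>1 \<le> X\<close>; the constant in
    \<open>R\<close> is 79 + 17 + 21.\<close>
  also have "\<dots> \<le> X * R" using X by (simp add: R_def algebra_simps)
  finally have "X ^ (k - 1) * (i_time n m M + 9) \<le> X ^ (k - 1) * (X * R)" by (rule mult_le_mono2)
  also have "\<dots> = X ^ k * R" using Xk by (simp add: mult.assoc[symmetric])
  finally have "X ^ (k - 1) * (i_time n m M + 9) + 22 \<le> X ^ k * R + 22 * X ^ k" using E by simp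
  \<comment> \<open>Here \<open>k \<le> n\<close> moves the number of levels into the
    polynomial.\<close>
  then have "k * (X ^ (k - 1) * (i_time n m M + 9) + 22) \<le> n * (X ^ k * R + 22 * X ^ k)"
    using assms(4) by (intro mult_le_mono)
  moreover have "l * (n * 15 + 23) \<le> X ^ k * (n * 15 + 23)" using E by (intro mult_le_mono1)
  moreover have "27 \<le> 27 * X ^ k" "n * 14 \<le> X ^ k * (n * 14)" using E by auto
  ultimately have "l * (n * 15 + 23) + 8 + (n * 14 + 13) +
      (k * (X ^ (k - 1) * (i_time n m M + 9) + 22) + 6)
     \<le> X ^ k * (n * 15 + 23) + X ^ k * (n * 14) + 27 * X ^ k + n *
         (X ^ k * R + 22 * X ^ k)" by linarith
  \<comment> \<open>The coefficients on the left add up to 50, 168, 70 and 66; the constant one is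
    rounded up.\<close>
  also have "\<dots> \<le> X ^ k * poly [:57, 168, 70, 66:] n"
    by (simp add: R_def algebra_simps)
  finally show ?thesis unfolding X_def .
qed

theorem theorem4p6:
  shows "\<exists>(prog :: com) (q :: nat poly).
    \<forall>(n :: nat) (m :: nat) (p :: nat \<Rightarrow> real vec pmf) (S :: nat \<Rightarrow> real vec list)
      (l :: nat) (r :: nat \<Rightarrow> real vec) (k :: nat).
      (\<forall>i\<in>{1..m}. finite (set_pmf (p i)) \<and> set_pmf (p i) \<subseteq> carrier_vec n \<and>
                   distinct (S i) \<and> set (S i) = set_pmf (p i)) \<longrightarrow>
      1 \<le> l \<longrightarrow> l \<le> m \<longrightarrow> (\<forall>i\<in>{1..l}. r i \<in> set_pmf (p i)) \<longrightarrow>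
      1 \<le> k \<longrightarrow> k \<le> n \<longrightarrow>
      (\<exists>t s. exec prog (input_state n m p S l r k) t s \<and>
             t \<le> (m * (MAX i\<in>{1..m}. card (set_pmf (p i)))) ^ k * poly q n \<and>
             top_coeffs n k (expected_charpoly n m p l r) (\<lambda>j. rmem s ''out'' [j]))"
proof (unfold runs_def[symmetric],
    rule exI[of _ "fixed_prog ;; root_prog ;; main_prog"], rule exI[of _ "[:57, 168, 70, 66:]"],
        intro allI impI)
  fix n m l k :: nat and p :: "nat \<Rightarrow> real vec pmf" and S :: "nat \<Rightarrow> real vec list" and r ::
      "nat \<Rightarrow> real vec"
  assume supp: "\<forall>i\<in>{1..m}. finite (set_pmf (p i)) \<and> set_pmf (p i) \<subseteq> carrier_vec n \<and>
                   distinct (S i) \<and> set (S i) = set_pmf (p i)"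
    and l: "1 \<le> l" "l \<le> m" and r: "\<forall>i\<in>{1..l}. r i \<in> set_pmf (p i)" and k: "1 \<le> k" "k \<le> n"
  define M where "M = (MAX i\<in>{1..m}. card (set_pmf (p i)))"
  define sz where "sz = eff_size l S"
  define V where "V = eff_vec l S r"
  define pr where "pr = eff_prob l p S"
  have cardM: "card (set_pmf (p i)) \<le> M" if "i \<in> {1..m}" for i
    unfolding M_def using that by (intro Max_ge) auto
  have card1: "1 \<le> card (set_pmf (p i))" if "i \<in> {1..m}" for i
    using supp that by (simp add: Suc_le_eq card_gt_0_iff set_pmf_not_empty)
  \<comment> \<open>Index 1 exists because \<open>1 \<le> l\<close> and \<open>l \<le> m\<close>,
    and the support of a distribution is not empty.\<close>
  have M: "0 < M" using card1[of 1] cardM[of 1] l by simp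
  have sz: "sz i \<le> M" if "i \<in> {1..m}" for i
    using cardM[OF that] card1[OF that] supp that distinct_card[of "S i"]
        by (auto simp: sz_def eff_size_def)
  have V: "V i a \<in> carrier_vec n" if "i \<in> {1..m}" "a < sz i" for i a
  proof (cases "i \<le> l")
    case True
    then have "r i \<in> set_pmf (p i)" "set_pmf (p i) \<subseteq> carrier_vec n" using r supp that by simp_all
    then show ?thesis using True by (auto simp: V_def eff_vec_def)
  next
    case False
    then have "S i ! a \<in> set (S i)" using that by (simp add: sz_def eff_size_def)
    then show ?thesis using False supp that by (auto simp: V_def eff_vec_def)
  qed
  have rV: "r i = V i 0" "pr i 0 = 1" "sz i = 1" if "i \<le> l" for i
    using that by (simp_all add: V_def eff_vec_def pr_def eff_prob_def sz_def eff_size_def)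
  let ?s0 = "input_state n m p S l r k"
  have s0: "nmem ?s0 ''n'' [] = n" "nmem ?s0 ''l'' [] = l" "nmem ?s0 ''m'' [] = m"
      "nmem ?s0 ''k'' [] = k"
    by (simp_all add: input_state_def scalar_def)
  have in1: "rmem ?s0 ''fixed'' [i, c] = V i 0 $ c" if "i \<in> {1..l}" "c < n" for i c
    using that rV by (simp add: input_state_def)
  have in2: "nmem ?s0 ''size'' [i] = sz i" if "i \<in> {1..m}" "l < i" for i
    using that by (simp add: input_state_def sz_def eff_size_def)
  have in3: "rmem ?s0 ''prob'' [i, a] = pr i a" if "i \<in> {1..m}" "l < i" "a < sz i" for i a
    using that by (simp add: input_state_def sz_def eff_size_def pr_def eff_prob_def)
  have in4: "rmem ?s0 ''supp'' [i, a, c] = V i a $ c" if "i \<in> {1..m}" "l < i" "a < sz i" "c < n"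
      for i a c
    using that by (simp add: input_state_def sz_def eff_size_def V_def eff_vec_def)
  have in0: "nmem ?s0 ''last'' x = 0" "rmem ?s0 ''P'' x = 0" "rmem ?s0 ''out'' x = 0" for x
    by (simp_all add: input_state_def)
  let ?T = "l * (n * 15 + 23) + 8 + (n * 14 + 13) +
      (k * ((m * M) ^ (k - 1) * (i_time n m M + 9) + 22) + 6)"
  have "runs (fixed_prog ;; root_prog ;; main_prog) ?s0 ?T
    (\<lambda>s. top_coeffs n k (expected_charpoly n m p l r) (\<lambda>j. rmem s ''out'' [j]))"
  proof (rule runs_Seq[OF runs_fixed_prog[OF s0(1,2)]], goal_cases)
    case (2 s1)
    have n1: "nmem s1 ''n'' [] = n" using 2 s0 by (simp add: frame_def)
    show ?case
    proof (rule runs_Seq[OF runs_root_prog[OF n1]], goal_cases)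
      case (2 s2)
      note s1 = \<open>frame _ _ ?s0 s1 \<and> _\<close>
      have sc: "nmem s2 ''n'' [] = n" "nmem s2 ''m'' [] = m" "nmem s2 ''k'' [] = k"
        "nmem s2 ''size'' = nmem s1 ''size''" "rmem s2 ''prob'' = rmem s1 ''prob''"
            "rmem s2 ''supp'' = rmem s1 ''supp''"
        "nmem s2 ''last'' [0, 0] = 0" "\<And>x. rmem s2 ''out'' x = 0" "\<And>x. rmem s1 ''P'' x = 0"
        using 2 s1 s0 in0 by (simp_all add: frame_def)
      have "nmem s2 ''size'' [i] = sz i \<and>
        (\<forall>a<sz i. rmem s2 ''prob'' [i, a] = pr i a \<and>
            (\<forall>c<n. rmem s2 ''supp'' [i, a, c] = V i a $ c))" if i: "i \<in> {1..m}" for i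
      proof (cases "i \<le> l")
        case True
        then have "i \<in> {1..l}" using i by simp
        then show ?thesis using s1 sc(4-6) rV[OF True] in1 by simp
      next
        case False
        then show ?thesis using s1 sc(4-6) in2[OF i] in3[OF i] in4[OF i] by simp
      qed
      then have inp: "holds_input n m k sz V pr s2" using sc by (simp add: holds_input_def)
      have "node_mat n s2 0 0 = 1\<^sub>m n"
        by (rule eq_matI) (use 2 sc in \<open>auto simp: node_mat_def\<close>)
      \<comment> \<open>The single node of level 0 has weight 1, so the functional is evaluation at
        the root.\<close>
      then have "node_sum n s2 0 (nmem s2 ''cnt'' [0]) F = F (1\<^sub>m n) 0" for F
        using 2 sc by (simp add: node_sum_def)
      then have "main_inv n m k M sz V pr 0 s2"
        using inp 2 sc by (simp add: main_inv_def)
      then have run: "runs main_prog s2 (k * ((m * M) ^ (k - 1) * (i_time n m M + 9) + 22) + 6)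
          (main_inv n m k M sz V pr k)"
        by (intro runs_main_prog) (use V sz M l in simp_all)
      show ?case
      proof (rule runs_mono[OF run], goal_cases)
        \<comment> \<open>At level \<open>k\<close> the invariant says that \<open>out\<close> holds
          the path sums of lengths 1 to \<open>k\<close>, which are the coefficients sought.\<close>
        case (2 s3)
        then show ?case
          by (intro top_coeffs_path_sum[OF supp l(2) r k(2)])
              (simp only: main_inv_def sz_def V_def pr_def)
      qed simp
    qed simp
  qed simp
  moreover have "?T \<le> (m * M) ^ k * poly [:57, 168, 70, 66:] n"
    by (rule total_time_bound) (use l k M in auto)
  ultimately show "runs (fixed_prog ;; root_prog ;; main_prog) ?s0
     ((m * (MAX i\<in>{1..m}. card (set_pmf (p i)))) ^ k * poly [:57, 168, 70, 66:] n)
     (\<lambda>s. top_coeffs n k (expected_charpoly n m p l r) (\<lambda>j. rmem s ''out'' [j]))"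
    unfolding M_def[symmetric] by (rule runs_mono)
qed

end
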